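(* Let $(X,d)$ be a compact metric space, $f:X\to X$ a continuous map and $\mu$ an ergodic $f$-invariant probability measure, with metric entropy $h_\mu$. For $\gamma\in(0,1)$ and any mistake function $g$, we have $$h_\mu=\lim_{\epsilon\to0}\liminf_{n\to\infty}\frac1n\log\big(\inf\{r_n(g;Z,\epsilon):Z\subset X,\ \mu(Z)\ge1-\gamma\}\big).$$ The formula remains true if we replace the $\liminf$ by $\limsup$ and/or $r_n(g;Z,\epsilon)$ by $s_n(g;Z,\epsilon)$. The value taken by the $\liminf$ can be bounded below independent of the choice of mistake function $g$.
   Context: **Mistake functions.** Let $\epsilon_0>0$. A function $g:\mathbb{N}\times(0,\epsilon_0]\to\mathbb{N}$ is a mistake function if for all $\epsilon\in(0,\epsilon_0]$ and all $n\in\mathbb{N}$, $g(n,\epsilon)\le g(n+1,\epsilon)$, and $\lim_{n\to\infty}g(n,\epsilon)/n=0$. For $\epsilon>\epsilon_0$ put $g(n,\epsilon):=g(n,\epsilon_0)$. For integers $m<n$ let $I(n,-m)=\{\Lambda\subseteq\{0,\dots,n-1\}:\#\Lambda\ge n-m\}$, and for a finite set of indices $\Lambda$ let $d_\Lambda(x,y)=\max\{d(f^jx,f^jy):j\in\Lambda\}$. **Separated and spanning sets.** Let $Z\subseteq X$, $\epsilon>0$, and let $n$ be such that $g(n,\epsilon)<n$. A set $S\subset Z$ is $(g;n,\epsilon)$ separated for $Z$ if for every $\Lambda\in I(n,-g(n,\epsilon))$ and all distinct $x,y\in S$, $d_\Lambda(x,y)>\epsilon$; equivalently, $\#\{j\in\{0,\dots,n-1\}:d(f^jx,f^jy)>\epsilon\}>g(n,\epsilon)$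 for all distinct $x,y\in S$. A set $S\subset Z$ is $(g;n,\epsilon)$ spanning for $Z$ if for every $x\in Z$ there exist $y\in S$ and $\Lambda\in I(n,-g(n,\epsilon))$ with $d_\Lambda(x,y)\le\epsilon$. Define $s_n(g;Z,\epsilon)=\sup\{\#S:S\text{ is }(g;n,\epsilon)\text{ separated for }Z\}$ and $r_n(g;Z,\epsilon)=\inf\{\#S:S\text{ is }(g;n,\epsilon)\text{ spanning for }Z\}$. For fixed $\epsilon$ these are defined for all sufficiently large $n$. *)

theory Defs
  imports "HOL-Probability.Probability" "HOL-Library.Disjoint_Sets" "HOL-Library.Extended_Nat"
begin

section \<open>Ergodic measures and metric entropy\<close>

definition invariant_measure :: "'a measure \<Rightarrow> ('a \<Rightarrow> 'a) \<Rightarrow> bool" where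
  "invariant_measure M f \<longleftrightarrow>
     f \<in> measurable M M \<and> (\<forall>A\<in>sets M. measure M (f -` A \<inter> space M) = measure M A)"

definition ergodic_measure :: "'a measure \<Rightarrow> ('a \<Rightarrow> 'a) \<Rightarrow> bool" where
  "ergodic_measure M f \<longleftrightarrow> invariant_measure M f \<and>
     (\<forall>A\<in>sets M. f -` A \<inter> space M = A \<longrightarrow> measure M A = 0 \<or> measure M A = 1)"

definition finite_measurable_partition :: "'a measure \<Rightarrow> 'a set set \<Rightarrow> bool" where
  "finite_measurable_partition M P \<longleftrightarrow> finite P \<and> P \<subseteq> sets M \<and> partition_on (space M) P"

text \<open>The convention \<open>0 * log 0 = 0\<close> is automatic; logarithms are natural throughout.\<close>

definition partition_entropy :: "'a measure \<Rightarrow> 'a set set \<Rightarrow> real" where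
  "partition_entropy M P = - (\<Sum>A\<in>P. measure M A * ln (measure M A))"

definition preimage_partition :: "'a measure \<Rightarrow> ('a \<Rightarrow> 'a) \<Rightarrow> 'a set set \<Rightarrow> 'a set set" where
  "preimage_partition M h P = (\<lambda>A. h -` A \<inter> space M) ` P - {{}}"

text \<open>The join of the preimages of \<open>P\<close> under \<open>f ^^ i\<close> for \<open>i < n\<close>.\<close>

definition dynamical_partition ::
    "'a measure \<Rightarrow> ('a \<Rightarrow> 'a) \<Rightarrow> 'a set set \<Rightarrow> nat \<Rightarrow> 'a set set" where
  "dynamical_partition M f P n =
     common_refinement ((\<lambda>i. preimage_partition M (f ^^ i) P) ` {..<n})"

definition entropy_wrt_partition :: "'a measure \<Rightarrow> ('a \<Rightarrow> 'a) \<Rightarrow> 'a set set \<Rightarrow> real" where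
  "entropy_wrt_partition M f P =
     lim (\<lambda>n. partition_entropy M (dynamical_partition M f P n) / real n)"

definition metric_entropy :: "'a measure \<Rightarrow> ('a \<Rightarrow> 'a) \<Rightarrow> ereal" where
  "metric_entropy M f =
     (SUP P\<in>{P. finite_measurable_partition M P}. ereal (entropy_wrt_partition M f P))"


section \<open>Mistake functions\<close>

text \<open>A mistake function is defined for \<open>0 < \<epsilon> \<le> \<epsilon>0\<close> and extended by its value at \<open>\<epsilon>0\<close> to
  all \<open>\<epsilon> > \<epsilon>0\<close>; the extension is the last conjunct. Values at \<open>\<epsilon> \<le> 0\<close> are irrelevant.\<close>

definition mistake_function :: "real \<Rightarrow> (nat \<Rightarrow> real \<Rightarrow> nat) \<Rightarrow> bool" where
  "mistake_function \<epsilon>0 g \<longleftrightarrow> \<epsilon>0 > 0 \<and>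
     (\<forall>\<epsilon>\<in>{0<..\<epsilon>0}. (\<forall>n. g n \<epsilon> \<le> g (n + 1) \<epsilon>) \<and>
        (\<lambda>n. real (g n \<epsilon>) / real n) \<longlonglongrightarrow> 0) \<and>
     (\<forall>\<epsilon>>\<epsilon>0. \<forall>n. g n \<epsilon> = g n \<epsilon>0)"


section \<open>Separated and spanning sets\<close>

text \<open>\<open>index_sets n m\<close> is the family written $I(n,-m)$ on paper.\<close>

definition index_sets :: "nat \<Rightarrow> nat \<Rightarrow> nat set set" where
  "index_sets n m = {\<Lambda>. \<Lambda> \<subseteq> {..<n} \<and> card \<Lambda> \<ge> n - m}"

definition dist_on :: "('a::metric_space \<Rightarrow> 'a) \<Rightarrow> nat set \<Rightarrow> 'a \<Rightarrow> 'a \<Rightarrow> real" where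
  "dist_on f \<Lambda> x y = Max ((\<lambda>j. dist ((f ^^ j) x) ((f ^^ j) y)) ` \<Lambda>)"

text \<open>The following notions are meaningful only for \<open>g n \<epsilon> < n\<close>, when every index set involved is
  nonempty. For a mistake function and fixed \<open>\<epsilon> > 0\<close> this holds for all large \<open>n\<close>, so the remaining
  \<open>n\<close> do not affect a limit superior or inferior as \<open>n\<close> tends to infinity.\<close>

definition mistake_separated ::
    "('a::metric_space \<Rightarrow> 'a) \<Rightarrow> (nat \<Rightarrow> real \<Rightarrow> nat) \<Rightarrow> nat \<Rightarrow> real \<Rightarrow> 'a set \<Rightarrow> 'a set \<Rightarrow> bool" where
  "mistake_separated f g n \<epsilon> Z S \<longleftrightarrow> S \<subseteq> Z \<and>
     (\<forall>\<Lambda>\<in>index_sets n (g n \<epsilon>). \<forall>x\<in>S. \<forall>y\<in>S. x \<noteq> y \<longrightarrow> dist_on f \<Lambda> x y > \<epsilon>)"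

definition mistake_spanning ::
    "('a::metric_space \<Rightarrow> 'a) \<Rightarrow> (nat \<Rightarrow> real \<Rightarrow> nat) \<Rightarrow> nat \<Rightarrow> real \<Rightarrow> 'a set \<Rightarrow> 'a set \<Rightarrow> bool" where
  "mistake_spanning f g n \<epsilon> Z S \<longleftrightarrow> S \<subseteq> Z \<and>
     (\<forall>x\<in>Z. \<exists>y\<in>S. \<exists>\<Lambda>\<in>index_sets n (g n \<epsilon>). dist_on f \<Lambda> x y \<le> \<epsilon>)"

definition ecard :: "'a set \<Rightarrow> enat" where
  "ecard S = (if finite S then enat (card S) else \<infinity>)"

definition sep_number ::
    "('a::metric_space \<Rightarrow> 'a) \<Rightarrow> (nat \<Rightarrow> real \<Rightarrow> nat) \<Rightarrow> nat \<Rightarrow> 'a set \<Rightarrow> real \<Rightarrow> enat" where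
  "sep_number f g n Z \<epsilon> = (SUP S\<in>{S. mistake_separated f g n \<epsilon> Z S}. ecard S)"

definition span_number ::
    "('a::metric_space \<Rightarrow> 'a) \<Rightarrow> (nat \<Rightarrow> real \<Rightarrow> nat) \<Rightarrow> nat \<Rightarrow> 'a set \<Rightarrow> real \<Rightarrow> enat" where
  "span_number f g n Z \<epsilon> = (INF S\<in>{S. mistake_spanning f g n \<epsilon> Z S}. ecard S)"

definition ln_enat :: "enat \<Rightarrow> ereal" where
  "ln_enat k = (case k of enat m \<Rightarrow> (if m = 0 then -\<infinity> else ereal (ln (real m))) | \<infinity> \<Rightarrow> \<infinity>)"

definition large_sets :: "'a measure \<Rightarrow> real \<Rightarrow> 'a set set" where
  "large_sets M \<gamma> = {Z \<in> sets M. measure M Z \<ge> 1 - \<gamma>}"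

definition sep_rate ::
    "'a::metric_space measure \<Rightarrow> ('a \<Rightarrow> 'a) \<Rightarrow> real \<Rightarrow> (nat \<Rightarrow> real \<Rightarrow> nat) \<Rightarrow> real \<Rightarrow> nat \<Rightarrow> ereal" where
  "sep_rate M f \<gamma> g \<epsilon> n = ln_enat (INF Z\<in>large_sets M \<gamma>. sep_number f g n Z \<epsilon>) / ereal (real n)"

definition span_rate ::
    "'a::metric_space measure \<Rightarrow> ('a \<Rightarrow> 'a) \<Rightarrow> real \<Rightarrow> (nat \<Rightarrow> real \<Rightarrow> nat) \<Rightarrow> real \<Rightarrow> nat \<Rightarrow> ereal" where
  "span_rate M f \<gamma> g \<epsilon> n = ln_enat (INF Z\<in>large_sets M \<gamma>. span_number f g n Z \<epsilon>) / ereal (real n)"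

end

theory Submission
  imports Defs "HOL-Real_Asymp.Real_Asymp"
begin

text \<open>For a finite partition, the set of points whose name of length \<open>n\<close> has, for infinitely many \<open>n\<close>,
  probability at least a constant times \<open>exp (- c * n)\<close> is mapped into itself, hence has measure 0 or 1;
  let \<open>h\<close> be the infimum of the \<open>c\<close> for which the measure is 1. Below \<open>h\<close>, almost all names of
  length \<open>n\<close> have probability less than \<open>exp (- c * n)\<close>. Above \<open>h\<close>, almost every point starts a
  heavy block of bounded length, so by Markov's inequality most orbit segments of length \<open>N\<close> parse
  into heavy blocks with few letters left over, and a Kraft inequality shows that there are at most
  \<open>exp (N * (h + \<delta>))\<close> such names. This is the Shannon--McMillan theorem in probability, it identifies
  \<open>h\<close> with the entropy of the partition, and it needs no ergodic theorem.

  The upper bound for separated sets follows by counting names for a partition into small atoms. For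
  the lower bound for spanning sets, replace the atoms by closed subsets of almost full measure, which
  lie at positive distance from each other. A mistake ball of small radius then contains, up to
  a set of small measure, only points whose names lie in one Hamming ball of small relative radius,
  and such a ball contains only \<open>exp (n * \<delta>)\<close> names.\<close>

section \<open>Measure-preserving maps\<close>

locale measure_preserving = prob_space M for M :: "'a measure" +
  fixes f :: "'a \<Rightarrow> 'a"
  assumes invariant: "invariant_measure M f"
begin

lemma measurable_f [measurable]: "f \<in> measurable M M"
  using invariant by (simp add: invariant_measure_def)

lemma measurable_funpow [measurable]: "f ^^ n \<in> measurable M M"
  by (induction n) (auto intro: measurable_comp)

lemma funpow_space: "x \<in> space M \<Longrightarrow> (f ^^ n) x \<in> space M"
  using measurable_space[OF measurable_funpow] .

lemma prob_vimage: "B \<in> sets M \<Longrightarrow> prob (f -` B \<inter> space M) = prob B"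
  using invariant by (simp add: invariant_measure_def)

lemma prob_funpow_vimage:
  assumes "B \<in> sets M"
  shows "prob ((f ^^ n) -` B \<inter> space M) = prob B"
proof (induction n)
  case 0
  then show ?case using sets.sets_into_space[OF assms] by (simp add: Int_absorb2)
next
  case (Suc n)
  have "(f ^^ Suc n) -` B \<inter> space M = f -` ((f ^^ n) -` B \<inter> space M) \<inter> space M"
    using measurable_space[OF measurable_f] by (auto simp: funpow_Suc_right simp del: funpow.simps)
  then show ?case
    using Suc prob_vimage[of "(f ^^ n) -` B \<inter> space M"] assms by (simp del: funpow.simps)
qed

text \<open>Markov's inequality for the number of visits takes the place of the ergodic theorem.\<close>

lemma prob_visits_le:
  assumes B: "B \<in> sets M" and \<theta>: "\<theta> > 0" and n: "n > 0"
  shows "prob {x \<in> space M. real (card {i. i < n \<and> (f ^^ i) x \<in> B}) \<ge> \<theta> * real n} \<le> prob B / \<theta>"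
proof -
  define u where "u x = (\<Sum>i<n. indicat_real B ((f ^^ i) x))" for x
  have meas [measurable]: "u \<in> borel_measurable M"
    unfolding u_def using B by measurable
  have u: "u x = real (card {i. i < n \<and> (f ^^ i) x \<in> B})" for x
  proof -
    have "u x = (\<Sum>i | i < n \<and> (f ^^ i) x \<in> B. 1)"
      unfolding u_def indicator_def by (intro sum.mono_neutral_cong_right) auto
    then show ?thesis by simp
  qed
  have "u x \<le> real n" for x
    unfolding u using card_mono[of "{..<n}" "{i. i < n \<and> (f ^^ i) x \<in> B}"] by auto
  then have ui: "integrable M u"
    by (intro integrable_const_bound[of _ "real n"]) (auto simp: u)
  \<comment> \<open>Invariance alone gives each of the \<open>n\<close> summands the expectation
    \<open>prob B\<close>.\<close>
  have "(\<integral>x. u x \<partial>M) = (\<Sum>i<n. prob ((f ^^ i) -` B \<inter> space M))"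
  proof -
    have "indicat_real B ((f ^^ i) x) = indicat_real ((f ^^ i) -` B \<inter> space M) x" if "x \<in> space M" for i x
      using that by (simp add: indicator_def)
    then have "(\<integral>x. u x \<partial>M) = (\<integral>x. (\<Sum>i<n. indicat_real ((f ^^ i) -` B \<inter> space M) x) \<partial>M)"
      unfolding u_def by (intro Bochner_Integration.integral_cong) auto
    also have "\<dots> = (\<Sum>i<n. prob ((f ^^ i) -` B \<inter> space M))"
      using B by (subst Bochner_Integration.integral_sum) (auto intro!: measurable_sets[OF measurable_funpow] simp: less_top[symmetric])
    finally show ?thesis .
  qed
  also have "\<dots> = real n * prob B"
    by (simp add: prob_funpow_vimage[OF B])
  finally have int: "(\<integral>x. u x \<partial>M) = real n * prob B" .
  have "prob {x \<in> space M. u x \<ge> \<theta> * real n} \<le> (\<integral>x. u x \<partial>M) / (\<theta> * real n)"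
    using \<theta> n by (intro integral_Markov_inequality_measure[where A="space M"] ui) (auto simp: u)
  then have "prob {x \<in> space M. u x \<ge> \<theta> * real n} \<le> prob B / \<theta>"
    unfolding int using n by simp
  then show ?thesis unfolding u .
qed

end

locale ergodic_system = measure_preserving +
  assumes ergodic: "ergodic_measure M f"
begin

text \<open>Ergodicity speaks only of sets equal to their preimage. The preimages of
  \<open>B\<close> under the iterates increase and all have the measure of \<open>B\<close>; their
  union \<open>C\<close> is strictly invariant, so \<open>B\<close> has the measure of
  \<open>C\<close>, which is 0 or 1.\<close>

lemma subinvariant_zero_one:
  assumes B: "B \<in> sets M" and sub: "\<And>x. x \<in> B \<Longrightarrow> f x \<in> B"
  shows "prob B = 0 \<or> prob B = 1"
proof -
  define C where "C = (\<Union>n. (f ^^ n) -` B \<inter> space M)"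
  have C: "C \<in> sets M"
    unfolding C_def using B by (intro sets.countable_UN image_subsetI measurable_sets[OF measurable_funpow])
  have "incseq (\<lambda>n. (f ^^ n) -` B \<inter> space M)"
    by (intro incseq_SucI) (auto intro: sub)
  then have "(\<lambda>n. prob ((f ^^ n) -` B \<inter> space M)) \<longlonglongrightarrow> prob C"
    unfolding C_def using B by (intro finite_Lim_measure_incseq) (auto intro: measurable_sets[OF measurable_funpow])
  then have eq: "prob C = prob B"
    using B by (simp add: prob_funpow_vimage LIMSEQ_const_iff)
  have "f -` C \<inter> space M = C"
  proof (intro set_eqI iffI)
    fix x assume "x \<in> f -` C \<inter> space M"
    then obtain n where "x \<in> space M" "(f ^^ Suc n) x \<in> B"
      unfolding C_def by (auto simp: funpow_Suc_right simp del: funpow.simps)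
    then show "x \<in> C" unfolding C_def by blast
  next
    fix x assume "x \<in> C"
    then obtain n where x: "x \<in> space M" "(f ^^ n) x \<in> B" unfolding C_def by auto
    then have "(f ^^ n) (f x) \<in> B" using sub[OF x(2)] by (simp add: funpow_swap1)
    then show "x \<in> f -` C \<inter> space M"
      using x(1) measurable_space[OF measurable_f] unfolding C_def by auto
  qed
  then show ?thesis
    using ergodic C eq unfolding ergodic_measure_def by metis
qed

end

section \<open>Names of orbit segments\<close>

definition words :: "'b set \<Rightarrow> nat \<Rightarrow> 'b list set" where
  "words A n = {w. set w \<subseteq> A \<and> length w = n}"

lemma finite_words: "finite A \<Longrightarrow> finite (words A n)"
  by (simp add: words_def finite_lists_length_eq)

lemma card_words: "finite A \<Longrightarrow> card (words A n) = card A ^ n"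
  by (simp add: words_def card_lists_length_eq)

lemma words_0: "words A 0 = {[]}"
  by (auto simp: words_def)

lemma sum_words_Suc:
  assumes "finite A"
  shows "(\<Sum>w\<in>words A (Suc n). F w) = (\<Sum>a\<in>A. \<Sum>w\<in>words A n. F (a # w))"
proof -
  have "words A (Suc n) = (\<lambda>(a, w). a # w) ` (A \<times> words A n)"
    by (auto simp: words_def image_iff length_Suc_conv)
  moreover have "inj_on (\<lambda>(a, w). a # w) (A \<times> words A n)"
    by (auto simp: inj_on_def)
  ultimately show ?thesis
    by (simp add: sum.reindex sum.cartesian_product case_prod_unfold)
qed

section \<open>Stationary processes with a finite alphabet, their names and cylinder
  measures\<close>

locale process = measure_preserving +
  fixes \<xi> :: "'a \<Rightarrow> 'b" and A :: "'b set"
  assumes finite_A: "finite A" and measurable_\<xi> [measurable]: "\<xi> \<in> measurable M (count_space A)"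
begin

definition name :: "nat \<Rightarrow> 'a \<Rightarrow> 'b list" where
  "name n x = map (\<lambda>i. \<xi> ((f ^^ i) x)) [0..<n]"

text \<open>The measure of a cylinder. The length is read off from the word, so that a single set of
  blocks can contain words of different lengths.\<close>

definition word_prob :: "'b list \<Rightarrow> real" where
  "word_prob w = prob {x \<in> space M. name (length w) x = w}"

lemma length_name [simp]: "length (name n x) = n"
  by (simp add: name_def)

lemma name_0 [simp]: "name 0 x = []"
  by (simp add: name_def)

lemma name_nth: "i < n \<Longrightarrow> name n x ! i = \<xi> ((f ^^ i) x)"
  by (simp add: name_def)

lemma name_eq_iff: "name n x = name n y \<longleftrightarrow> (\<forall>i<n. \<xi> ((f ^^ i) x) = \<xi> ((f ^^ i) y))"
  by (auto simp: list_eq_iff_nth_eq name_nth)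

lemma name_in_words: "x \<in> space M \<Longrightarrow> name n x \<in> words A n"
  using measurable_space[OF measurable_\<xi>] funpow_space by (auto simp: name_def words_def)

lemma take_name: "m \<le> n \<Longrightarrow> take m (name n x) = name m x"
  by (simp add: name_def take_map)

lemma drop_name: "drop m (name n x) = name (n - m) ((f ^^ m) x)"
  by (rule nth_equalityI) (auto simp: name_nth funpow_add[THEN fun_cong, unfolded o_def, symmetric] add.commute)

lemma name_Suc: "name (Suc n) x = \<xi> x # name n (f x)"
  using drop_name[of 1 "Suc n" x] name_nth[of 0 "Suc n" x] length_name[of "Suc n" x]
  by (cases "name (Suc n) x") auto

lemma measurable_name [measurable]: "name n \<in> measurable M (count_space (words A n))"
proof (subst measurable_count_space_eq2[OF finite_words[OF finite_A]], intro conjI ballI)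
  show "name n \<in> space M \<rightarrow> words A n"
    using name_in_words by auto
  fix w assume w: "w \<in> words A n"
  have "name n -` {w} \<inter> space M = {x \<in> space M. \<forall>i\<in>{..<n}. \<xi> ((f ^^ i) x) \<in> {w ! i} \<inter> A}"
  proof -
    have "name n x = w \<longleftrightarrow> (\<forall>i\<in>{..<n}. \<xi> ((f ^^ i) x) \<in> {w ! i} \<inter> A)" if "x \<in> space M" for x
      using w funpow_space[OF that] measurable_space[OF measurable_\<xi>]
      by (auto simp: list_eq_iff_nth_eq name_nth words_def)
    then show ?thesis by auto
  qed
  also have "\<dots> \<in> sets M"
  proof (rule sets.sets_Collect_finite_All, goal_cases)
    case (1 i)
    have "(\<lambda>x. \<xi> ((f ^^ i) x)) -` ({w ! i} \<inter> A) \<inter> space M \<in> sets M"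
      by (rule measurable_sets[where A="count_space A"]) auto
    moreover have "(\<lambda>x. \<xi> ((f ^^ i) x)) -` ({w ! i} \<inter> A) \<inter> space M
      = {x \<in> space M. \<xi> ((f ^^ i) x) \<in> {w ! i} \<inter> A}"
      by auto
    ultimately show ?case by simp
  qed auto
  finally show "name n -` {w} \<inter> space M \<in> sets M" .
qed

lemma sets_name: "{x \<in> space M. P (name n x)} \<in> sets M"
proof -
  have "name n -` ({w. P w} \<inter> words A n) \<inter> space M \<in> sets M"
    by (rule measurable_sets[OF measurable_name]) auto
  moreover have "name n -` ({w. P w} \<inter> words A n) \<inter> space M = {x \<in> space M. P (name n x)}"
    using name_in_words by auto
  ultimately show ?thesis by simp
qed

lemma prob_name:
  "prob {x \<in> space M. P (name n x)} = (\<Sum>w | w \<in> words A n \<and> P w. word_prob w)"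
proof -
  have "{x \<in> space M. P (name n x)} = (\<Union>w\<in>{w \<in> words A n. P w}. {x \<in> space M. name n x = w})"
    using name_in_words by auto
  also have "prob \<dots> = (\<Sum>w | w \<in> words A n \<and> P w. prob {x \<in> space M. name n x = w})"
    by (intro finite_measure_finite_Union)
       (auto simp: disjoint_family_on_def finite_A finite_words intro: sets_name)
  also have "\<dots> = (\<Sum>w | w \<in> words A n \<and> P w. word_prob w)"
    by (intro sum.cong) (auto simp: word_prob_def words_def)
  finally show ?thesis .
qed

lemma sum_word_prob: "(\<Sum>w\<in>words A n. word_prob w) = 1"
  using prob_name[of "\<lambda>_. True" n] by (simp add: prob_space)

lemma word_prob_nonneg: "word_prob w \<ge> 0" and word_prob_le_1: "word_prob w \<le> 1"
  by (auto simp: word_prob_def)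

text \<open>The cylinder of \<open>name (Suc n) x\<close> lies in the preimage of the cylinder of
  \<open>name n (f x)\<close>, which has the same measure as that cylinder. This makes the set
  \<open>heavy c\<close> below forward invariant.\<close>

lemma word_prob_name_Suc_le: "x \<in> space M \<Longrightarrow> word_prob (name (Suc n) x) \<le> word_prob (name n (f x))"
proof -
  have "word_prob (name (Suc n) x) \<le> prob (f -` {y \<in> space M. name n y = name n (f x)} \<inter> space M)"
    unfolding word_prob_def
    by (intro finite_measure_mono measurable_sets[OF measurable_f] sets_name)
       (auto simp: name_Suc dest: measurable_space[OF measurable_f])
  also have "\<dots> = word_prob (name n (f x))"
    by (subst prob_vimage[OF sets_name]) (simp add: word_prob_def)
  finally show ?thesis .
qed

lemma card_A_pos: "card A > 0"
proof -
  obtain x where "x \<in> space M" using not_empty by blast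
  then show ?thesis
    using measurable_space[OF measurable_\<xi>] finite_A card_gt_0_iff by fastforce
qed

text \<open>The probabilities of all words of one length sum to 1. This supplies the counts of
  blocks in the Kraft inequality.\<close>

lemma card_heavy_words:
  assumes "t > 0"
  shows "real (card {w \<in> words A n. word_prob w \<ge> t}) \<le> 1 / t"
proof -
  have "real (card {w \<in> words A n. word_prob w \<ge> t}) * t \<le> (\<Sum>w\<in>{w \<in> words A n. word_prob w \<ge> t}. word_prob w)"
    by (rule sum_bounded_below) auto
  also have "\<dots> \<le> (\<Sum>w\<in>words A n. word_prob w)"
    by (intro sum_mono2 finite_words finite_A) (auto intro: word_prob_nonneg)
  finally show ?thesis using assms by (simp add: sum_word_prob field_simps)
qed

end

section \<open>Parsings of words into blocks and a Kraft inequality\<close>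

lemma sum_words_add:
  assumes "finite A"
  shows "(\<Sum>w\<in>words A (m + n). F w) = (\<Sum>u\<in>words A m. \<Sum>v\<in>words A n. F (u @ v))"
proof (induction m arbitrary: F)
  case 0
  then show ?case by (simp add: words_0)
next
  case (Suc m)
  then show ?case by (simp add: sum_words_Suc assms)
qed

text \<open>The total weight of all parsings of a word into blocks from \<open>D\<close> of length in \<open>{L..m}\<close>, each
  weighted \<open>exp (- s * n)\<close>, and single letters, each weighted \<open>z\<close>. Under a Kraft inequality
  the words of any given length have total weight at most 1, so few of them can have a parsing with
  few single letters.\<close>

fun parse_weight :: "'b list set \<Rightarrow> nat \<Rightarrow> nat \<Rightarrow> real \<Rightarrow> real \<Rightarrow> 'b list \<Rightarrow> real" where
  "parse_weight D L m s z [] = 1"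
| "parse_weight D L m s z (a # w) = z * parse_weight D L m s z w +
     (\<Sum>n=L..m. if n \<le> Suc (length w) \<and> take n (a # w) \<in> D
        then exp (- s * real n) * parse_weight D L m s z (drop (n - 1) w) else 0)"

lemma parse_weight_nonneg: "z \<ge> 0 \<Longrightarrow> parse_weight D L m s z w \<ge> 0"
  by (induction w rule: length_induct, case_tac xs)
     (auto intro!: add_nonneg_nonneg mult_nonneg_nonneg sum_nonneg)

text \<open>Strong induction on \<open>N\<close>, splitting off the first piece of a parsing: what
  remains is a word of smaller length, with total weight at most 1, and \<open>kraft\<close> says
  that all possible first pieces together weigh at most 1.\<close>

lemma sum_parse_weight_le_1:
  assumes A: "finite A" and z: "z \<ge> 0" and L: "L \<ge> 1"
    and kraft: "real (card A) * z + (\<Sum>n=L..m. real (card (D \<inter> words A n)) * exp (- s * real n)) \<le> 1"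
  shows "(\<Sum>w\<in>words A N. parse_weight D L m s z w) \<le> 1"
proof (induction N rule: less_induct)
  case (less N)
  let ?p = "parse_weight D L m s z"
  show ?case
  proof (cases N)
    case 0
    then show ?thesis by (simp add: words_0)
  next
    case (Suc K)
    \<comment> \<open>The contribution of the parsings that begin with a block of length
      \<open>n\<close>. Since \<open>n \<ge> L \<ge> 1\<close>, the list
      \<open>drop (n - 1) w\<close> is \<open>drop n (a # w)\<close>.\<close>
    define B where "B n w = (if n \<le> length w \<and> take n w \<in> D then exp (- s * real n) * ?p (drop n w) else 0)"
      for n w
    have p_Cons: "?p (a # w) = z * ?p w + (\<Sum>n=L..m. B n (a # w))" for a w
      using L by (auto simp: B_def drop_Cons' intro!: sum.cong)
    have block: "(\<Sum>w\<in>words A N. B n w) \<le> real (card (D \<inter> words A n)) * exp (- s * real n)"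
      if n: "n \<in> {L..m}" for n
    proof (cases "n \<le> N")
      case True
      \<comment> \<open>Cutting each word after \<open>n\<close> letters factors the sum into the
        choice of a block from \<open>D\<close> and the total weight at length
        \<open>N - n < N\<close>.\<close>
      have "(\<Sum>w\<in>words A N. B n w) = (\<Sum>u\<in>words A n. \<Sum>v\<in>words A (N - n). B n (u @ v))"
        using sum_words_add[OF A, of "B n" n "N - n"] True by simp
      also have "\<dots> = (\<Sum>u\<in>words A n. if u \<in> D then exp (- s * real n) * (\<Sum>v\<in>words A (N - n). ?p v) else 0)"
        by (intro sum.cong) (auto simp: B_def words_def sum_distrib_left)
      also have "\<dots> \<le> (\<Sum>u\<in>words A n. if u \<in> D then exp (- s * real n) else 0)"
        using less.IH[of "N - n"] n L Suc by (intro sum_mono) auto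
      also have "\<dots> = (\<Sum>u\<in>D \<inter> words A n. exp (- s * real n))"
        using A by (subst Int_commute, subst sum.inter_restrict) (auto simp: finite_words)
      finally show ?thesis by simp
    next
      case False
      then have "(\<Sum>w\<in>words A N. B n w) = 0"
        by (intro sum.neutral) (auto simp: B_def words_def)
      then show ?thesis by simp
    qed
    have "(\<Sum>w\<in>words A N. ?p w) = (\<Sum>a\<in>A. \<Sum>w\<in>words A K. z * ?p w) +
        (\<Sum>a\<in>A. \<Sum>w\<in>words A K. \<Sum>n=L..m. B n (a # w))"
      unfolding Suc sum_words_Suc[OF A] p_Cons by (simp only: sum.distrib)
    also have "(\<Sum>a\<in>A. \<Sum>w\<in>words A K. \<Sum>n=L..m. B n (a # w)) = (\<Sum>w\<in>words A N. \<Sum>n=L..m. B n w)"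
      by (simp add: Suc sum_words_Suc[OF A])
    also have "\<dots> = (\<Sum>n=L..m. \<Sum>w\<in>words A N. B n w)"
      by (rule sum.swap)
    also have "\<dots> \<le> (\<Sum>n=L..m. real (card (D \<inter> words A n)) * exp (- s * real n))"
      by (intro sum_mono block)
    also have "(\<Sum>a\<in>A. \<Sum>w\<in>words A K. z * ?p w) = real (card A) * z * (\<Sum>w\<in>words A K. ?p w)"
      by (simp add: sum_distrib_left mult.assoc)
    also have "\<dots> \<le> real (card A) * z * 1"
      using less.IH[of K] Suc z by (intro mult_left_mono) auto
    finally show ?thesis using kraft by simp
  qed
qed

context process
begin

text \<open>One parsing already has this weight, the greedy one: at a point of \<open>G\<close> with
  at least \<open>m\<close> letters left, take a block that it starts, otherwise a single letter.
  The factor \<open>exp (- s * N)\<close> pays for the blocks, and each single letter costs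
  \<open>z\<close>.\<close>

lemma parse_weight_name_ge:
  assumes z: "0 < z" "z \<le> 1" and s: "s \<ge> 0" and L: "L \<ge> 1"
    and G: "\<And>x. x \<in> G \<Longrightarrow> \<exists>n\<in>{L..m}. name n x \<in> D"
  shows "exp (- s * real N) * z ^ card {i. i < N \<and> ((f ^^ i) x \<notin> G \<or> i + m > N)}
           \<le> parse_weight D L m s z (name N x)"
proof (induction N arbitrary: x rule: less_induct)
  case (less N)
  let ?p = "parse_weight D L m s z"
  \<comment> \<open>The times at which the greedy parsing may have to spend a single letter: the
    orbit is outside \<open>G\<close>, or fewer than \<open>m\<close> letters are left.\<close>
  define b where "b N x = {i. i < N \<and> ((f ^^ i) x \<notin> G \<or> i + m > N)}" for N x
  have fin: "finite (b N x)" for N x unfolding b_def by simp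
  have IH: "exp (- s * real K) * z ^ card (b K y) \<le> ?p (name K y)" if "K < N" for K y
    using less.IH[OF that] by (simp add: b_def)
  have nn: "?p w \<ge> 0" for w using z by (simp add: parse_weight_nonneg)
  have "exp (- s * real N) * z ^ card (b N x) \<le> ?p (name N x)"
  proof (cases N)
    case 0
    then show ?thesis by (simp add: b_def)
  next
    case (Suc K)
    have pN: "?p (name N x) = z * ?p (name K (f x)) +
     (\<Sum>n=L..m. if n \<le> Suc K \<and> take n (name N x) \<in> D
        then exp (- s * real n) * ?p (drop (n - 1) (name K (f x))) else 0)"
      unfolding Suc name_Suc by simp
    have snn: "(if n \<le> Suc K \<and> take n (name N x) \<in> D
        then exp (- s * real n) * ?p (drop (n - 1) (name K (f x))) else 0) \<ge> 0" for n
      by (simp add: nn)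
    show ?thesis
    proof (cases "x \<in> G \<and> m \<le> N")
      case True
      then obtain n where n: "n \<in> {L..m}" "name n x \<in> D" using G by blast
      have nN: "n \<le> N" "n > 0" using n True L by auto
      have dr: "drop (n - 1) (name K (f x)) = name (N - n) ((f ^^ n) x)"
        using drop_name[of n N x] nN by (cases n) (simp_all add: Suc name_Suc)
      \<comment> \<open>The condition that few letters are left is measured from the end of the
        segment, so a shift by \<open>n\<close> turns bad times of the remaining segment into bad
        times of the whole one.\<close>
      have "(\<lambda>j. j + n) ` b (N - n) ((f ^^ n) x) \<subseteq> b N x"
        using nN by (auto simp: b_def funpow_add)
      then have "card (b (N - n) ((f ^^ n) x)) \<le> card (b N x)"
        by (intro card_inj_on_le[OF _ _ fin, of "\<lambda>j. j + n"]) auto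
      then have "exp (- s * real N) * z ^ card (b N x)
          \<le> exp (- s * real N) * z ^ card (b (N - n) ((f ^^ n) x))"
        using z by (intro mult_left_mono power_decreasing) auto
      also have "\<dots> = exp (- s * real n) * (exp (- s * real (N - n)) * z ^ card (b (N - n) ((f ^^ n) x)))"
        using nN by (simp add: mult.assoc[symmetric] exp_add[symmetric] of_nat_diff algebra_simps)
      also have "\<dots> \<le> exp (- s * real n) * ?p (name (N - n) ((f ^^ n) x))"
        using nN by (intro mult_left_mono IH) auto
      also have "\<dots> = (if n \<le> Suc K \<and> take n (name N x) \<in> D
          then exp (- s * real n) * ?p (drop (n - 1) (name K (f x))) else 0)"
        using n nN dr by (simp add: take_name Suc)
      also have "\<dots> \<le> (\<Sum>n=L..m. if n \<le> Suc K \<and> take n (name N x) \<in> D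
          then exp (- s * real n) * ?p (drop (n - 1) (name K (f x))) else 0)"
        using n by (intro member_le_sum snn) auto
      also have "\<dots> \<le> ?p (name N x)"
        unfolding pN using z nn by simp
      finally show ?thesis .
    next
      case False
      \<comment> \<open>Time 0 is itself bad, which pays for the factor \<open>z\<close> of the
        single letter.\<close>
      have "insert 0 (Suc ` b K (f x)) \<subseteq> b N x"
        using False Suc by (auto simp: b_def funpow_Suc_right simp del: funpow.simps)
      then have "card (insert 0 (Suc ` b K (f x))) \<le> card (b N x)"
        by (intro card_mono fin)
      then have "Suc (card (b K (f x))) \<le> card (b N x)"
        by (subst (asm) card_insert_disjoint) (auto simp: fin card_image)
      then have "exp (- s * real N) * z ^ card (b N x) \<le> exp (- s * real K) * z ^ Suc (card (b K (f x)))"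
        using z s Suc by (intro mult_mono power_decreasing) (auto simp: mult_left_mono)
      also have "\<dots> = z * (exp (- s * real K) * z ^ card (b K (f x)))"
        by simp
      also have "\<dots> \<le> z * ?p (name K (f x))"
        using z Suc by (intro mult_left_mono IH) auto
      also have "\<dots> \<le> ?p (name N x)"
        unfolding pN by (simp add: sum_nonneg snn del: atLeastAtMost_iff)
      finally show ?thesis .
    qed
  qed
  then show ?case by (simp add: b_def)
qed

end

text \<open>Blocks of length at least \<open>L\<close> will use at most half of the Kraft budget.
  The bound is uniform in \<open>m\<close> because the maximal block length is chosen after
  \<open>L\<close>.\<close>

lemma geometric_tail:
  fixes \<delta> :: real assumes "\<delta> > 0"
  shows "\<exists>L\<ge>1. \<forall>m. (\<Sum>n=L..m. exp (- \<delta> * real n)) \<le> 1 / 2"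
proof -
  define r where "r = exp (- \<delta>)"
  have r: "0 < r" "r < 1" using assms by (auto simp: r_def)
  have pow: "exp (- \<delta> * real n) = r ^ n" for n
    by (simp add: r_def exp_of_nat_mult[symmetric] mult.commute)
  have "(\<lambda>L. r ^ L / (1 - r)) \<longlonglongrightarrow> 0 / (1 - r)"
    using r by (intro tendsto_intros LIMSEQ_realpow_zero) auto
  then have "\<forall>\<^sub>F L in sequentially. r ^ L / (1 - r) < 1 / 2"
    using r by (intro order_tendstoD(2)[where y=0]) auto
  then obtain L where L: "L \<ge> 1" "r ^ L / (1 - r) < 1 / 2"
    using eventually_happens[OF eventually_conj[OF eventually_ge_at_top[of 1]]] by force
  have "(\<Sum>n=L..m. r ^ n) \<le> 1 / 2" for m
  proof (cases "L \<le> m")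
    case True
    then have "(\<Sum>n=L..m. r ^ n) = (r ^ L - r ^ Suc m) / (1 - r)"
      using r by (simp add: sum_gp)
    also have "\<dots> \<le> r ^ L / (1 - r)"
      using r by (intro divide_right_mono) auto
    finally show ?thesis using L(2) by linarith
  qed simp
  then show ?thesis using L(1) unfolding pow by blast
qed

section \<open>The entropy rate of an ergodic process\<close>

locale ergodic_process = process + ergodic_system
begin

text \<open>Up to the borderline case of equality, the points where the lower limit of
  \<open>- ln (word_prob (name n x)) / n\<close> is below \<open>c\<close>. The free constant
  \<open>K\<close> absorbs the factor \<open>exp (- c)\<close> lost when the first letter is
  dropped, so that the set is mapped into itself.\<close>

definition heavy :: "real \<Rightarrow> 'a set" where
  "heavy c = {x \<in> space M. \<exists>K>0. \<exists>\<^sub>\<infinity>n. word_prob (name n x) \<ge> K * exp (- c * real n)}"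

lemma sets_heavy: "heavy c \<in> sets M"
proof -
  \<comment> \<open>Restricting \<open>K\<close> to the values \<open>1 / Suc m\<close> exhibits the
    set as a countable combination of unions of cylinders.\<close>
  define E where "E m n = {x \<in> space M. word_prob (name n x) \<ge> (1 / real (Suc m)) * exp (- c * real n)}" for m n
  have "heavy c = (\<Union>m. \<Inter>N. \<Union>n\<in>{N..}. E m n)" (is "_ = ?R")
  proof (intro set_eqI iffI)
    fix x assume "x \<in> heavy c"
    then obtain K where x: "x \<in> space M" and K: "K > 0" "\<exists>\<^sub>\<infinity>n. word_prob (name n x) \<ge> K * exp (- c * real n)"
      by (auto simp: heavy_def)
    obtain m where m: "1 / real (Suc m) < K"
      using reals_Archimedean[OF K(1)] by (auto simp: inverse_eq_divide)
    have *: "\<exists>n\<in>{N..}. x \<in> E m n" for N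
    proof -
      obtain n where "n \<ge> N" "word_prob (name n x) \<ge> K * exp (- c * real n)"
        using K(2) unfolding INFM_nat_le by blast
      moreover have "(1 / real (Suc m)) * exp (- c * real n) \<le> K * exp (- c * real n)"
        using m by (intro mult_right_mono) auto
      ultimately have "x \<in> E m n" using x unfolding E_def by (blast intro: order_trans)
      then show ?thesis using \<open>n \<ge> N\<close> by blast
    qed
    show "x \<in> ?R" by (rule UN_I[OF UNIV_I], rule INT_I, rule UN_iff[THEN iffD2], rule *)
  next
    fix x assume "x \<in> ?R"
    then obtain m where m: "x \<in> (\<Inter>N. \<Union>n\<in>{N..}. E m n)"
      by (rule UN_E)
    have *: "\<exists>n\<ge>N. x \<in> E m n" for N
      using INT_D[OF m, of N] by auto
    have "\<exists>\<^sub>\<infinity>n. word_prob (name n x) \<ge> (1 / real (Suc m)) * exp (- c * real n)"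
      unfolding INFM_nat_le using * unfolding E_def by blast
    moreover have "x \<in> space M"
      using * by (auto simp: E_def)
    ultimately show "x \<in> heavy c"
      unfolding heavy_def by (blast intro: divide_pos_pos zero_less_one of_nat_0_less_iff[THEN iffD2] zero_less_Suc)
  qed
  also have "\<dots> \<in> sets M"
    unfolding E_def
    by (intro sets.countable_UN sets.countable_INT image_subsetI sets_name sets.countable_UN') auto
  finally show ?thesis .
qed

lemma f_heavy:
  assumes "x \<in> heavy c" shows "f x \<in> heavy c"
proof -
  obtain K where x: "x \<in> space M" and K: "K > 0" "\<exists>\<^sub>\<infinity>n. word_prob (name n x) \<ge> K * exp (- c * real n)"
    using assms by (auto simp: heavy_def)
  have "\<exists>n\<ge>N. word_prob (name n (f x)) \<ge> (K * exp (- c)) * exp (- c * real n)" for N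
  proof -
    obtain n where n: "n \<ge> Suc N" "word_prob (name n x) \<ge> K * exp (- c * real n)"
      using K(2) by (auto simp: INFM_nat_le)
    then obtain n' where n': "n = Suc n'" by (cases n) auto
    have "(K * exp (- c)) * exp (- c * real n') = K * exp (- c * real n)"
      by (simp add: n' exp_add[symmetric] mult.assoc algebra_simps)
    also have "\<dots> \<le> word_prob (name n' (f x))"
      using n(2) word_prob_name_Suc_le[OF x, of n'] by (simp add: n')
    finally show ?thesis using n n' by auto
  qed
  then show ?thesis
    using x K(1) measurable_space[OF measurable_f x] unfolding heavy_def INFM_nat_le
    by (auto intro!: exI[of _ "K * exp (- c)"])
qed

lemma prob_heavy: "prob (heavy c) = 0 \<or> prob (heavy c) = 1"
  by (rule subinvariant_zero_one[OF sets_heavy f_heavy])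

text \<open>For negative \<open>c\<close> the threshold \<open>K * exp (- c * n)\<close> eventually
  exceeds 1. This bounds the infimum in \<open>entropy_rate\<close> from below.\<close>

lemma heavy_neg_empty:
  assumes "c < 0" shows "heavy c = {}"
proof (rule ccontr)
  assume "heavy c \<noteq> {}"
  then obtain x K where K: "K > 0" "\<exists>\<^sub>\<infinity>n. word_prob (name n x) \<ge> K * exp (- c * real n)"
    by (auto simp: heavy_def)
  obtain N where N: "real N * (- c) > 1 / K"
    using reals_Archimedean3[of "- c"] assms by auto
  obtain n where n: "n \<ge> N" "word_prob (name n x) \<ge> K * exp (- c * real n)"
    using K(2) by (auto simp: INFM_nat_le)
  have "real N * (- c) \<le> real n * (- c)"
    using n(1) assms by (intro mult_right_mono) auto
  then have "1 / K < 1 + - c * real n"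
    using N by (simp add: mult.commute)
  also have "\<dots> \<le> exp (- c * real n)"
    by (rule exp_ge_add_one_self)
  finally have "1 < K * exp (- c * real n)"
    using K(1) by (simp add: field_simps)
  then show False using n(2) word_prob_le_1[of "name n x"] by linarith
qed

text \<open>There are \<open>card A ^ n\<close> words of length \<open>n\<close>, so those lighter
  than \<open>exp (- c * n)\<close> have total probability at most \<open>exp (- n)\<close>. Hence
  almost no point has light names from some length on, and the infimum in
  \<open>entropy_rate\<close> is over a nonempty set.\<close>

lemma prob_heavy_large: "prob (heavy (ln (real (card A)) + 1)) = 1"
proof -
  define c where "c = ln (real (card A)) + 1"
  define U where "U N = {x \<in> space M. \<forall>n\<in>{N..}. \<not> word_prob (name n x) \<ge> exp (- c * real n)}" for N
  have U [measurable]: "U N \<in> sets M" for N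
    unfolding U_def by (intro sets.sets_Collect_countable_Ball sets_name)
  have "prob (U N) \<le> exp (- real n)" if "n \<ge> N" for n N
  proof -
    have "prob (U N) \<le> prob {x \<in> space M. word_prob (name n x) < exp (- c * real n)}"
      using that by (intro finite_measure_mono sets_name) (auto simp: U_def not_le)
    also have "\<dots> = (\<Sum>w | w \<in> words A n \<and> word_prob w < exp (- c * real n). word_prob w)"
      by (rule prob_name)
    also have "\<dots> \<le> (\<Sum>w | w \<in> words A n \<and> word_prob w < exp (- c * real n). exp (- c * real n))"
      by (intro sum_mono) auto
    also have "\<dots> \<le> (\<Sum>w\<in>words A n. exp (- c * real n))"
      by (intro sum_mono2 finite_words finite_A) auto
    also have "\<dots> = real (card A) ^ n * exp (- c * real n)"
      by (simp add: card_words finite_A)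
    also have "real (card A) ^ n = exp (real n * ln (real (card A)))"
      using card_A_pos by (simp add: exp_of_nat_mult)
    also have "exp (real n * ln (real (card A))) * exp (- c * real n) = exp (- real n)"
      by (simp add: c_def exp_add[symmetric] algebra_simps)
    finally show ?thesis .
  qed
  moreover have "(\<lambda>n. exp (- real n)) \<longlonglongrightarrow> 0"
    by real_asymp
  ultimately have "prob (U N) \<le> 0" for N
    by (intro tendsto_lowerbound[where f="\<lambda>n. exp (- real n)" and F=sequentially])
       (auto simp: eventually_sequentially)
  then have U0: "U N \<in> null_sets M" for N
    using measure_nonneg[of M "U N"] by (intro null_setsI) (auto simp: emeasure_eq_measure intro: antisym)
  then have "(\<Union>N. U N) \<in> null_sets M" by blast
  moreover have "space M - heavy c \<subseteq> (\<Union>N. U N)"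
  proof
    fix x assume x: "x \<in> space M - heavy c"
    then have "\<not> (\<exists>\<^sub>\<infinity>n. word_prob (name n x) \<ge> 1 * exp (- c * real n))"
      unfolding heavy_def by (blast intro: zero_less_one)
    then show "x \<in> (\<Union>N. U N)" using x by (auto simp: INFM_nat_le U_def)
  qed
  ultimately have "prob (space M - heavy c) = 0"
    by (intro measure_eq_0_null_sets) (rule null_sets_subset[OF _ sets.compl_sets[OF sets_heavy]])
  then show ?thesis
    using prob_compl[OF sets_heavy[of c]] by (simp add: c_def)
qed

text \<open>The almost sure value of the lower limit of
  \<open>- ln (word_prob (name n x)) / n\<close>. It turns out to be the entropy of the
  process.\<close>

definition entropy_rate :: real where
  "entropy_rate = Inf {c. prob (heavy c) = 1}"

lemma prob_heavy_1_nonneg: "prob (heavy c) = 1 \<Longrightarrow> c \<ge> 0"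
  using heavy_neg_empty[of c] by (cases "c < 0") auto

lemma bdd_below_heavy: "bdd_below {c. prob (heavy c) = 1}"
  by (rule bdd_belowI[of _ 0]) (simp add: prob_heavy_1_nonneg)

lemma entropy_rate_nonneg: "entropy_rate \<ge> 0"
  unfolding entropy_rate_def
  by (rule cInf_greatest) (use prob_heavy_large in \<open>auto simp: prob_heavy_1_nonneg\<close>)

text \<open>By the zero-one law \<open>heavy c\<close> is null. With \<open>K = 1\<close> it
  contains the points in infinitely many of these events, so the tail unions \<open>V N\<close>
  decrease to a null set.\<close>

lemma prob_heavy_words_tendsto_0:
  assumes "c < entropy_rate"
  shows "(\<lambda>n. prob {x \<in> space M. word_prob (name n x) \<ge> exp (- c * real n)}) \<longlonglongrightarrow> 0"
proof -
  have "prob (heavy c) \<noteq> 1"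
    using assms cInf_lower[OF _ bdd_below_heavy, of c] unfolding entropy_rate_def by auto
  then have h0: "prob (heavy c) = 0" using prob_heavy by blast
  define V where "V N = {x \<in> space M. \<exists>n\<in>{N..}. word_prob (name n x) \<ge> exp (- c * real n)}" for N
  have V: "V N \<in> sets M" for N
    unfolding V_def by (intro sets.sets_Collect_countable_Bex sets_name)
  have "(\<Inter>N. V N) \<subseteq> heavy c"
    unfolding V_def heavy_def INFM_nat_le by (auto simp: Bex_def intro!: exI[of _ "1::real"])
  then have "prob (\<Inter>N. V N) = 0"
    using h0 finite_measure_mono[OF _ sets_heavy, of "\<Inter>N. V N" c] by (simp add: measure_le_0_iff)
  moreover have "(\<lambda>N. prob (V N)) \<longlonglongrightarrow> prob (\<Inter>N. V N)"
    using V by (intro finite_Lim_measure_decseq) (auto simp: V_def decseq_def)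
  ultimately have "(\<lambda>N. prob (V N)) \<longlonglongrightarrow> 0" by simp
  then show ?thesis
  proof (rule tendsto_sandwich[OF _ _ tendsto_const, rotated 2])
    show "\<forall>\<^sub>F n in sequentially. prob {x \<in> space M. word_prob (name n x) \<ge> exp (- c * real n)} \<le> prob (V n)"
      by (intro always_eventually allI finite_measure_mono V) (auto simp: V_def)
  qed auto
qed

text \<open>The upper half of Shannon-McMillan. Few words have a large parse weight, by the Kraft
  inequality; a typical name has one, since its orbit seldom visits \<open>B\<close>, the set of
  points that start no heavy block of bounded length.\<close>

lemma names_concentrated:
  assumes "\<delta> > 0" "\<eta> > 0"
  shows "\<forall>\<^sub>F N in sequentially. \<exists>W \<subseteq> words A N. real (card W) \<le> exp (real N * (entropy_rate + \<delta>)) \<and>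
           prob {x \<in> space M. name N x \<in> W} \<ge> 1 - \<eta>"
proof -
  \<comment> \<open>One portion each for \<open>c1\<close> above the rate, for \<open>c\<close>
    above \<open>c1\<close> (absorbing \<open>K\<close>), for \<open>s\<close> above
    \<open>c\<close> (geometric decay of the block weights), for single letters at visits to
    \<open>B\<close>, and for single letters near the end of the segment.\<close>
  define d where "d = \<delta> / 5"
  have d: "d > 0" using assms by (simp add: d_def)
  obtain c1 where c1: "prob (heavy c1) = 1" "c1 < entropy_rate + d"
    using cInf_lessD[of "{c. prob (heavy c) = 1}" "entropy_rate + d"] prob_heavy_large d
    unfolding entropy_rate_def by auto
  have c1_nonneg: "c1 \<ge> 0"
    using c1(1) by (rule prob_heavy_1_nonneg)
  define c where "c = c1 + d"
  define s where "s = c + d"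
  have s0: "s \<ge> 0" using c1_nonneg d by (simp add: s_def c_def)
  obtain L where L: "L \<ge> 1" "\<And>m. (\<Sum>n=L..m. exp (- d * real n)) \<le> 1 / 2"
    using geometric_tail[OF d] by auto
  define D where "D = {w. word_prob w \<ge> exp (- c * real (length w))}"
  \<comment> \<open>Single letters take the other half of the Kraft budget:
    \<open>card A * z = 1 / 2\<close>. Each costs a factor \<open>z = exp (- l)\<close>.\<close>
  define z where "z = 1 / (2 * real (card A))"
  have z: "0 < z" "z \<le> 1" using card_A_pos by (auto simp: z_def)
  define l where "l = ln (1 / z)"
  have l: "l \<ge> 0" using z by (simp add: l_def)
  define \<theta> where "\<theta> = d / (l + 1)"
  have \<theta>: "\<theta> > 0" "\<theta> * l \<le> d"
    using d l by (auto simp: \<theta>_def field_simps)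
  define G where "G m = {x \<in> space M. \<exists>n\<in>{L..m}. name n x \<in> D}" for m
  have G: "G m \<in> sets M" for m
    unfolding G_def by (intro sets.sets_Collect_finite_Ex sets_name) auto
  have "(\<lambda>m. prob (G m)) \<longlonglongrightarrow> prob (\<Union>m. G m)"
    using G by (intro finite_Lim_measure_incseq) (force simp: incseq_def G_def)+
  moreover have "prob (\<Union>m. G m) = 1"
  proof -
    have "heavy c1 \<subseteq> (\<Union>m. G m)"
    proof
      fix x assume "x \<in> heavy c1"
      then obtain K where x: "x \<in> space M" and K: "K > 0" "\<exists>\<^sub>\<infinity>n. word_prob (name n x) \<ge> K * exp (- c1 * real n)"
        by (auto simp: heavy_def)
      have "(\<lambda>n. exp (- d * real n)) \<longlonglongrightarrow> 0"
        using d by real_asymp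
      then have "\<forall>\<^sub>F n in sequentially. exp (- d * real n) < K"
        using K(1) by (rule order_tendstoD)
      then obtain n0 where "\<And>n. n \<ge> n0 \<Longrightarrow> exp (- d * real n) < K"
        unfolding eventually_sequentially by blast
      moreover obtain n where "n \<ge> max L n0" "word_prob (name n x) \<ge> K * exp (- c1 * real n)"
        using K(2) unfolding INFM_nat_le by blast
      ultimately have n: "word_prob (name n x) \<ge> K * exp (- c1 * real n)" "n \<ge> L" "exp (- d * real n) < K"
        by auto
      have "exp (- c * real n) = exp (- d * real n) * exp (- c1 * real n)"
        by (simp add: c_def exp_add[symmetric] algebra_simps)
      also have "\<dots> \<le> K * exp (- c1 * real n)"
        using n(3) by (intro mult_right_mono) auto
      finally have "name n x \<in> D" using n(1) by (simp add: D_def)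
      then show "x \<in> (\<Union>m. G m)" using x n(2) unfolding G_def by force
    qed
    then have "prob (heavy c1) \<le> prob (\<Union>m. G m)"
      using G by (intro finite_measure_mono) auto
    then show ?thesis using c1(1) prob_le_1 by (metis antisym)
  qed
  \<comment> \<open>The complement \<open>B\<close> of \<open>G m\<close> must have measure below
    \<open>\<theta> * \<eta>\<close>, because Markov's inequality divides by
    \<open>\<theta>\<close>.\<close>
  ultimately have "\<forall>\<^sub>F m in sequentially. prob (G m) > 1 - \<theta> * \<eta>"
    using \<theta>(1) assms(2) by (intro order_tendstoD(1)[where y=1]) auto
  then obtain m where m: "prob (G m) > 1 - \<theta> * \<eta>"
    using eventually_happens by force
  define B where "B = space M - G m"
  have B: "B \<in> sets M" "prob B / \<theta> \<le> \<eta>"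
    using G[of m] m \<theta>(1) prob_compl[OF G[of m]] by (auto simp: B_def field_simps)
  have kraft: "real (card A) * z + (\<Sum>n=L..m. real (card (D \<inter> words A n)) * exp (- s * real n)) \<le> 1"
  proof -
    have "real (card (D \<inter> words A n)) * exp (- s * real n) \<le> exp (- d * real n)" for n
    proof -
      have "D \<inter> words A n = {w \<in> words A n. word_prob w \<ge> exp (- c * real n)}"
        by (auto simp: D_def words_def)
      then have "real (card (D \<inter> words A n)) \<le> 1 / exp (- c * real n)"
        using card_heavy_words[of "exp (- c * real n)" n] by simp
      then have "real (card (D \<inter> words A n)) * exp (- s * real n) \<le> 1 / exp (- c * real n) * exp (- s * real n)"
        by (rule mult_right_mono) simp
      also have "\<dots> = exp (- d * real n)"
        by (simp add: s_def exp_minus[symmetric] divide_inverse exp_add[symmetric] algebra_simps)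
      finally show ?thesis .
    qed
    then have "(\<Sum>n=L..m. real (card (D \<inter> words A n)) * exp (- s * real n)) \<le> 1 / 2"
      using sum_mono[of "{L..m}" _ "\<lambda>n. exp (- d * real n)"] L(2)[of m] by (meson order_trans)
    then show ?thesis using card_A_pos by (simp add: z_def)
  qed
  have "\<forall>\<^sub>F N in sequentially. real m * l \<le> real N * d"
    using d by real_asymp
  then show ?thesis
    using eventually_gt_at_top[of 0]
  proof eventually_elim
    case (elim N)
    define b where "b x = card {i. i < N \<and> (f ^^ i) x \<in> B}" for x
    define t where "t = exp (- real N * (entropy_rate + \<delta>))"
    \<comment> \<open>The threshold \<open>t\<close> is the least weight that the greedy parsing
      guarantees for a typical name. As the total weight is at most 1, at most \<open>1 / t\<close>
      words reach it.\<close>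
    define W where "W = {w \<in> words A N. parse_weight D L m s z w \<ge> t}"
    have "real (card W) * t \<le> (\<Sum>w\<in>W. parse_weight D L m s z w)"
      by (rule sum_bounded_below) (auto simp: W_def)
    also have "\<dots> \<le> (\<Sum>w\<in>words A N. parse_weight D L m s z w)"
      using z by (intro sum_mono2 finite_words finite_A) (auto simp: W_def parse_weight_nonneg)
    also have "\<dots> \<le> 1"
      using finite_A z L(1) kraft by (intro sum_parse_weight_le_1) auto
    finally have "real (card W) \<le> 1 / t"
      by (simp add: t_def pos_le_divide_eq)
    then have card_W: "real (card W) \<le> exp (real N * (entropy_rate + \<delta>))"
      by (simp add: t_def exp_minus divide_inverse)
    have "name N x \<in> W" if x: "x \<in> space M" "real (b x) < \<theta> * real N" for x
    proof -
      let ?S = "{i. i < N \<and> ((f ^^ i) x \<notin> G m \<or> i + m > N)}"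
      have "?S \<subseteq> {i. i < N \<and> (f ^^ i) x \<in> B} \<union> {N - m..<N}"
        using funpow_space[OF x(1)] by (auto simp: B_def)
      then have "card ?S \<le> card ({i. i < N \<and> (f ^^ i) x \<in> B} \<union> {N - m..<N})"
        by (rule card_mono[rotated]) auto
      also have "\<dots> \<le> b x + m"
        unfolding b_def by (rule order_trans[OF card_Un_le]) auto
      finally have "real (card ?S) * l \<le> (\<theta> * real N + real m) * l"
        using x(2) l by (intro mult_right_mono) linarith+
      also have "\<dots> = real N * (\<theta> * l) + real m * l"
        by (simp add: algebra_simps)
      also have "\<dots> \<le> real N * d + real N * d"
        using elim(1) \<theta>(2) by (intro add_mono mult_left_mono) auto
      finally have S: "real (card ?S) * l \<le> 2 * (real N * d)" by (simp add: mult.commute)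
      have "real N * s + real (card ?S) * l \<le> real N * (entropy_rate + \<delta>)"
      proof -
        have "real N * s \<le> real N * (entropy_rate + 3 * d)"
          using c1(2) by (intro mult_left_mono) (auto simp: s_def c_def)
        then show ?thesis using S by (simp add: d_def algebra_simps)
      qed
      then have "t \<le> exp (- s * real N) * exp (- l * real (card ?S))"
        unfolding t_def exp_add[symmetric] by (simp add: algebra_simps)
      also have "exp (- l * real (card ?S)) = z ^ card ?S"
        using z by (simp add: l_def ln_div exp_of_nat2_mult)
      also have "exp (- s * real N) * z ^ card ?S \<le> parse_weight D L m s z (name N x)"
        using z s0 L(1) by (intro parse_weight_name_ge) (auto simp: G_def)
      finally show ?thesis using name_in_words[OF x(1)] by (simp add: W_def)
    qed
    then have "space M - {x \<in> space M. real (b x) \<ge> \<theta> * real N} \<subseteq> {x \<in> space M. name N x \<in> W}"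
      by auto
    moreover have meas: "{x \<in> space M. real (b x) \<ge> \<theta> * real N} \<in> sets M"
      unfolding b_def using B(1) by measurable
    ultimately have "prob (space M - {x \<in> space M. real (b x) \<ge> \<theta> * real N}) \<le> prob {x \<in> space M. name N x \<in> W}"
      by (intro finite_measure_mono sets_name)
    moreover have "prob {x \<in> space M. real (b x) \<ge> \<theta> * real N} \<le> \<eta>"
      unfolding b_def using prob_visits_le[OF B(1) \<theta>(1) elim(2)] B(2) by linarith
    ultimately have "prob {x \<in> space M. name N x \<in> W} \<ge> 1 - \<eta>"
      using prob_compl[OF meas] by linarith
    then show ?case using card_W by (intro exI[of _ W]) (auto simp: W_def)
  qed
qed

end

section \<open>The entropy rate as the limit of normalized block entropies\<close>

context ergodic_process
begin

text \<open>The upper bound is Gibbs' inequality against the weights \<open>r\<close>, which are uniform at scale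
  \<open>exp (- n * (entropy_rate + \<delta>))\<close> on the typical words and uniform on all words otherwise.\<close>

lemma word_entropy_tendsto:
  "(\<lambda>n. - (\<Sum>w\<in>words A n. word_prob w * ln (word_prob w)) / real n) \<longlonglongrightarrow> entropy_rate"
proof (rule order_tendstoI)
  fix a assume a: "a < entropy_rate"
  define \<delta> where "\<delta> = (entropy_rate - a) / 2"
  define c where "c = entropy_rate - \<delta>"
  have c: "a < c" "c < entropy_rate" using a by (auto simp: \<delta>_def c_def field_simps)
  let ?p = "\<lambda>n. prob {x \<in> space M. word_prob (name n x) \<ge> exp (- c * real n)}"
  have "(\<lambda>n. c * (1 - ?p n)) \<longlonglongrightarrow> c * (1 - 0)"
    by (intro tendsto_intros prob_heavy_words_tendsto_0 c)
  then have "\<forall>\<^sub>F n in sequentially. a < c * (1 - ?p n)"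
    using c by (intro order_tendstoD) auto
  then show "\<forall>\<^sub>F n in sequentially. a < - (\<Sum>w\<in>words A n. word_prob w * ln (word_prob w)) / real n"
    using eventually_gt_at_top[of 0]
  proof eventually_elim
    case (elim n)
    \<comment> \<open>Lower bound: each word lighter than \<open>exp (- c * n)\<close> contributes
      at least \<open>c * n\<close> times its probability, and the other words contribute at least
      0.\<close>
    have "c * real n * (1 - ?p n) = (\<Sum>w\<in>words A n. c * real n * (word_prob w - (if word_prob w \<ge> exp (- c * real n) then word_prob w else 0)))"
      using prob_name[of "\<lambda>w. word_prob w \<ge> exp (- c * real n)" n]
      by (simp add: sum_distrib_left[symmetric] sum_subtractf sum_word_prob sum.inter_filter finite_words finite_A)
    also have "\<dots> \<le> (\<Sum>w\<in>words A n. - (word_prob w * ln (word_prob w)))"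
    proof (intro sum_mono)
      fix w
      show "c * real n * (word_prob w - (if word_prob w \<ge> exp (- c * real n) then word_prob w else 0)) \<le> - (word_prob w * ln (word_prob w))"
      proof (cases "word_prob w \<ge> exp (- c * real n) \<or> word_prob w = 0")
        case True
        have "ln (word_prob w) \<le> 0 \<or> word_prob w = 0" using word_prob_le_1[of w] word_prob_nonneg[of w] by (cases "word_prob w = 0") auto
        then show ?thesis using True word_prob_nonneg[of w] by (auto simp: mult_nonneg_nonpos)
      next
        case False
        then have "word_prob w > 0" "word_prob w < exp (- c * real n)" using word_prob_nonneg[of w] by auto
        then have "ln (word_prob w) < - c * real n" by (metis exp_less_cancel_iff exp_ln)
        then have "word_prob w * (c * real n) \<le> word_prob w * (- ln (word_prob w))"
          using \<open>word_prob w > 0\<close> by (intro mult_left_mono) auto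
        then show ?thesis using False by (simp add: mult.commute)
      qed
    qed
    finally have "c * (1 - ?p n) * real n \<le> - (\<Sum>w\<in>words A n. word_prob w * ln (word_prob w))"
      by (simp add: sum_negf algebra_simps)
    then have "c * (1 - ?p n) \<le> - (\<Sum>w\<in>words A n. word_prob w * ln (word_prob w)) / real n"
      using elim(2) by (subst pos_le_divide_eq) auto
    then show ?case using elim(1) by linarith
  qed
next
  fix a assume a: "entropy_rate < a"
  define \<delta> where "\<delta> = (a - entropy_rate) / 4"
  have \<delta>: "\<delta> > 0" "a = entropy_rate + 4 * \<delta>" using a by (auto simp: \<delta>_def field_simps)
  define k where "k = real (card A)"
  have k: "k \<ge> 1" using card_A_pos by (auto simp: k_def)
  \<comment> \<open>Atypical words, of total probability at most \<open>\<eta>\<close> and counted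
    with \<open>ln k\<close> per letter, then cost at most \<open>\<delta>\<close> per
    letter.\<close>
  define \<eta> where "\<eta> = \<delta> / (ln k + 1)"
  have \<eta>: "\<eta> > 0" "\<eta> * ln k \<le> \<delta>" using k \<delta> by (auto simp: \<eta>_def field_simps add_pos_nonneg)
  have "\<forall>\<^sub>F n in sequentially. ln 2 / real n < \<delta>"
    using \<delta> by real_asymp
  then show "\<forall>\<^sub>F n in sequentially. - (\<Sum>w\<in>words A n. word_prob w * ln (word_prob w)) / real n < a"
    using names_concentrated[OF \<delta>(1) \<eta>(1)] eventually_gt_at_top[of 0]
  proof eventually_elim
    case (elim n)
    obtain W where W: "W \<subseteq> words A n" "real (card W) \<le> exp (real n * (entropy_rate + \<delta>))"
      "prob {x \<in> space M. name n x \<in> W} \<ge> 1 - \<eta>"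
      using elim(2) by blast
    define Q where "Q = (\<Sum>w\<in>W. word_prob w)"
    have "{w. w \<in> words A n \<and> w \<in> W} = W" using W(1) by auto
    then have Q: "1 - \<eta> \<le> Q" using W(3) prob_name[of "\<lambda>w. w \<in> W" n] by (simp add: Q_def)
    have fin: "finite W" using W(1) finite_words[OF finite_A] finite_subset by blast
    have split: "(\<Sum>w\<in>words A n. g w) = (\<Sum>w\<in>W. g w) + (\<Sum>w\<in>words A n - W. g w)" for g :: "_ \<Rightarrow> real"
      using sum.subset_diff[OF W(1) finite_words[OF finite_A], of g] by simp
    have Q': "(\<Sum>w\<in>words A n - W. word_prob w) = 1 - Q" using split[of word_prob] by (simp add: sum_word_prob Q_def)
    have Q1: "Q \<le> 1" using Q' sum_nonneg[of "words A n - W" word_prob] by (simp add: word_prob_nonneg)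
    define u where "u w = (if w \<in> W then real n * (entropy_rate + \<delta>) else real n * ln k)" for w
    \<comment> \<open>The factor 1/2 lets the typical words and the remaining words each have total
      weight at most 1/2.\<close>
    define r where "r w = exp (- u w) / 2" for w
    have "(\<Sum>w\<in>words A n. r w) \<le> 1"
    proof -
      have "(\<Sum>w\<in>W. r w) = real (card W) * (exp (- (real n * (entropy_rate + \<delta>))) / 2)"
        by (simp add: r_def u_def)
      also have "\<dots> \<le> exp (real n * (entropy_rate + \<delta>)) * (exp (- (real n * (entropy_rate + \<delta>))) / 2)"
        by (intro mult_right_mono W) auto
      also have "\<dots> = 1 / 2"
        by (simp add: exp_minus)
      finally have 1: "(\<Sum>w\<in>W. r w) \<le> 1 / 2" .
      have "(\<Sum>w\<in>words A n - W. r w) = (\<Sum>w\<in>words A n - W. exp (- (real n * ln k)) / 2)"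
        by (intro sum.cong) (auto simp: r_def u_def)
      also have "\<dots> \<le> (\<Sum>w\<in>words A n. exp (- (real n * ln k)) / 2)"
        by (intro sum_mono2 finite_words finite_A) auto
      also have "\<dots> = k ^ n * (exp (- (real n * ln k)) / 2)"
        by (simp add: card_words finite_A k_def)
      also have "k ^ n = exp (real n * ln k)"
        using k by (simp add: exp_of_nat_mult)
      also have "exp (real n * ln k) * (exp (- (real n * ln k)) / 2) = 1 / 2"
        by (simp add: exp_minus)
      finally show ?thesis using 1 split[of r] by simp
    qed
    \<comment> \<open>This is \<open>ln t \<le> t - 1\<close> at
      \<open>t = r w / word_prob w\<close>. Summed over all words, the correction
      \<open>r w - word_prob w\<close> is at most 0.\<close>
    have gibbs: "- (word_prob w * ln (word_prob w)) \<le> word_prob w * (ln 2 + u w) + (r w - word_prob w)" for w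
    proof (cases "word_prob w = 0")
      case True then show ?thesis by (simp add: r_def)
    next
      case False
      then have qw: "word_prob w > 0" using word_prob_nonneg[of w] by simp
      have rw: "r w > 0" by (simp add: r_def)
      have "ln (r w / word_prob w) \<le> r w / word_prob w - 1"
        using qw rw by (intro ln_le_minus_one) auto
      then have "ln (r w) - ln (word_prob w) \<le> r w / word_prob w - 1"
        using qw rw by (simp add: ln_div)
      then have "word_prob w * (ln (r w) - ln (word_prob w)) \<le> word_prob w * (r w / word_prob w - 1)"
        using qw by (intro mult_left_mono) auto
      moreover have "ln (r w) = - u w - ln 2" by (simp add: r_def ln_div)
      ultimately show ?thesis using qw by (simp add: algebra_simps)
    qed
    have "- (\<Sum>w\<in>words A n. word_prob w * ln (word_prob w)) \<le> (\<Sum>w\<in>words A n. word_prob w * (ln 2 + u w) + (r w - word_prob w))"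
      unfolding sum_negf[symmetric] by (intro sum_mono gibbs)
    also have "\<dots> = ln 2 + (\<Sum>w\<in>words A n. word_prob w * u w) + ((\<Sum>w\<in>words A n. r w) - 1)"
      by (simp add: sum.distrib sum_subtractf distrib_left sum_word_prob sum_distrib_right[symmetric])
    also have "\<dots> \<le> ln 2 + (\<Sum>w\<in>words A n. word_prob w * u w)"
      using \<open>(\<Sum>w\<in>words A n. r w) \<le> 1\<close> by simp
    also have "(\<Sum>w\<in>words A n. word_prob w * u w) = Q * (real n * (entropy_rate + \<delta>)) + (1 - Q) * (real n * ln k)"
      unfolding split[of "\<lambda>w. word_prob w * u w"] Q'[symmetric] unfolding Q_def sum_distrib_right
      by (simp add: u_def)
    also have "\<dots> \<le> 1 * (real n * (entropy_rate + \<delta>)) + \<eta> * (real n * ln k)"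
      using Q Q1 k entropy_rate_nonneg \<delta> by (intro add_mono mult_right_mono) auto
    also have "\<dots> = real n * (entropy_rate + \<delta>) + real n * (\<eta> * ln k)"
      by simp
    also have "\<dots> \<le> real n * (entropy_rate + \<delta>) + real n * \<delta>"
      using \<eta> by (intro add_left_mono mult_left_mono) auto
    finally have "- (\<Sum>w\<in>words A n. word_prob w * ln (word_prob w)) \<le> ln 2 + real n * (entropy_rate + 2 * \<delta>)"
      by (simp add: algebra_simps)
    also have "\<dots> < real n * a"
    proof -
      have "ln 2 < real n * \<delta>" using elim by (simp add: field_simps)
      moreover have "0 < real n * \<delta>" using elim(3) \<delta> by simp
      ultimately show ?thesis by (simp add: \<delta>(2) algebra_simps)
    qed
    finally show ?case using elim(3) by (simp add: field_simps)
  qed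
qed

end

section \<open>Finite partitions as processes whose letters are the atoms\<close>

definition atom :: "'a set set \<Rightarrow> 'a \<Rightarrow> 'a set" where
  "atom P x = (THE B. B \<in> P \<and> x \<in> B)"

lemma atom_eq:
  assumes "partition_on X P" "B \<in> P" "x \<in> B"
  shows "atom P x = B"
  unfolding atom_def using assms
  by (intro the_equality) (auto simp: partition_on_def disjoint_def)

lemma atom_in:
  assumes "partition_on X P" "x \<in> X"
  shows "atom P x \<in> P" "x \<in> atom P x"
proof -
  obtain B where "B \<in> P" "x \<in> B" using assms by (auto simp: partition_on_def)
  then show "atom P x \<in> P" "x \<in> atom P x" using atom_eq[OF assms(1)] by auto
qed

locale partition_process = measure_preserving +
  fixes P :: "'a set set"
  assumes partition: "finite_measurable_partition M P"

sublocale partition_process \<subseteq> process M f "atom P" P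
proof
  have part: "partition_on (space M) P" and fin: "finite P" and sets: "P \<subseteq> sets M"
    using partition by (auto simp: finite_measurable_partition_def)
  show "finite P" by fact
  have "atom P -` {B} \<inter> space M = B" if "B \<in> P" for B
    using atom_in[OF part] atom_eq[OF part that] sets.sets_into_space[of B M] subsetD[OF sets that] by auto
  then show "atom P \<in> measurable M (count_space P)"
    using sets fin atom_in[OF part] by (subst measurable_count_space_eq2) auto
qed

context partition_process
begin

text \<open>For \<open>n = 0\<close> the set of partitions that is refined is empty and \<open>dynamical_partition\<close> is not
  a partition of \<open>space M\<close>.\<close>

lemma dynamical_partition_eq:
  assumes n: "n > 0"
  shows "dynamical_partition M f P n = (\<lambda>x. {y \<in> space M. name n y = name n x}) ` space M"
proof -
  have part: "partition_on (space M) P"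
    using partition by (auto simp: finite_measurable_partition_def)
  define R where "R i = preimage_partition M (f ^^ i) P" for i
  define C where "C i x = (f ^^ i) -` atom P ((f ^^ i) x) \<inter> space M" for i x
  \<comment> \<open>Exactly one member of each refined partition contains \<open>x\<close>, namely
    \<open>C i x\<close>.\<close>
  have R: "Q \<in> R i \<and> x \<in> Q \<longleftrightarrow> Q = C i x" if x: "x \<in> space M" for Q i x
  proof
    assume "Q \<in> R i \<and> x \<in> Q"
    then obtain B where "B \<in> P" "Q = (f ^^ i) -` B \<inter> space M" "x \<in> Q"
      by (auto simp: R_def preimage_partition_def)
    then show "Q = C i x" using atom_eq[OF part, of B "(f ^^ i) x"] by (auto simp: C_def)
  next
    assume Q: "Q = C i x"
    then have "x \<in> Q" using x atom_in(2)[OF part funpow_space[OF x]] by (auto simp: C_def)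
    then show "Q \<in> R i \<and> x \<in> Q"
      using Q atom_in(1)[OF part funpow_space[OF x]] by (auto simp: R_def preimage_partition_def C_def)
  qed
  have cyl: "(\<Inter>i<n. C i x) = {y \<in> space M. name n y = name n x}" if x: "x \<in> space M" for x
  proof -
    have "y \<in> C i x \<longleftrightarrow> atom P ((f ^^ i) y) = atom P ((f ^^ i) x)" if y: "y \<in> space M" for i y
      using y atom_in[OF part funpow_space[OF y]] atom_in[OF part funpow_space[OF x]]
        atom_eq[OF part, of _ "(f ^^ i) y"] by (fastforce simp: C_def)
    moreover have "(\<Inter>i<n. C i x) \<subseteq> space M" using n by (auto simp: C_def)
    ultimately show ?thesis by (auto simp: name_eq_iff)
  qed
  show ?thesis
    unfolding dynamical_partition_def common_refinement
  proof (intro set_eqI iffI)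
    fix E assume "E \<in> (\<Union>F\<in>Pi ((\<lambda>i. preimage_partition M (f ^^ i) P) ` {..<n}) (\<lambda>P. P).
      {\<Inter> (F ` ((\<lambda>i. preimage_partition M (f ^^ i) P) ` {..<n}))}) - {{}}"
    then obtain F where F: "\<And>i. i < n \<Longrightarrow> F (R i) \<in> R i" and E: "E = (\<Inter>i<n. F (R i))" "E \<noteq> {}"
      by (auto simp: R_def)
    then obtain x where x: "x \<in> E" by auto
    have "x \<in> F (R 0)" using x n by (auto simp: E)
    then have xs: "x \<in> space M" using F[OF n] by (auto simp: R_def preimage_partition_def)
    have "F (R i) = C i x" if "i < n" for i
      using R[OF xs, of "F (R i)" i] F[OF that] x that by (auto simp: E)
    then have "E = (\<Inter>i<n. C i x)" by (simp add: E)
    then show "E \<in> (\<lambda>x. {y \<in> space M. name n y = name n x}) ` space M"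
      using cyl[OF xs] xs by auto
  next
    fix E assume "E \<in> (\<lambda>x. {y \<in> space M. name n y = name n x}) ` space M"
    then obtain x where x: "x \<in> space M" "E = {y \<in> space M. name n y = name n x}" by auto
    \<comment> \<open>The choice function takes a partition, not an index, as its argument, since
      different \<open>i\<close> may give the same partition. Selecting the member that contains
      \<open>x\<close> is consistent across such repetitions.\<close>
    define F where "F S = (THE Q. Q \<in> S \<and> x \<in> Q)" for S :: "'a set set"
    have F: "F (R i) = C i x" for i
      unfolding F_def R[OF x(1)] by simp
    have "E = (\<Inter>i<n. F (R i))" unfolding F cyl[OF x(1)] x(2) ..
    moreover have "F (R i) \<in> R i" for i using F R[OF x(1)] by auto
    moreover have "x \<in> E" using x by auto
    ultimately show "E \<in> (\<Union>F\<in>Pi ((\<lambda>i. preimage_partition M (f ^^ i) P) ` {..<n}) (\<lambda>P. P).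
      {\<Inter> (F ` ((\<lambda>i. preimage_partition M (f ^^ i) P) ` {..<n}))}) - {{}}"
      unfolding R_def by (auto intro!: bexI[of _ F])
  qed
qed

text \<open>Nonempty cylinders correspond one to one to realised names. Words that no orbit realises
  have probability 0 and add only zero terms.\<close>

lemma partition_entropy_dynamical:
  assumes n: "n > 0"
  shows "partition_entropy M (dynamical_partition M f P n) = - (\<Sum>w\<in>words P n. word_prob w * ln (word_prob w))"
proof -
  let ?c = "\<lambda>w. {x \<in> space M. name n x = w}"
  have "dynamical_partition M f P n = ?c ` (name n ` space M)"
    unfolding dynamical_partition_eq[OF assms] by (auto simp: image_image)
  moreover have "inj_on ?c (name n ` space M)"
    by (auto simp: inj_on_def)
  ultimately have "partition_entropy M (dynamical_partition M f P n)
      = - (\<Sum>w\<in>name n ` space M. prob (?c w) * ln (prob (?c w)))"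
    by (simp add: partition_entropy_def sum.reindex)
  also have "(\<Sum>w\<in>name n ` space M. prob (?c w) * ln (prob (?c w))) = (\<Sum>w\<in>name n ` space M. word_prob w * ln (word_prob w))"
    by (intro sum.cong) (auto simp: word_prob_def)
  also have "\<dots> = (\<Sum>w\<in>words P n. word_prob w * ln (word_prob w))"
  proof (intro sum.mono_neutral_left finite_words finite_A)
    show "name n ` space M \<subseteq> words P n" using name_in_words by auto
    show "\<forall>w\<in>words P n - name n ` space M. word_prob w * ln (word_prob w) = 0"
    proof
      fix w assume w: "w \<in> words P n - name n ` space M"
      then have "{x \<in> space M. name (length w) x = w} = {}" by (auto simp: words_def image_iff)
      then show "word_prob w * ln (word_prob w) = 0" by (simp only: word_prob_def measure_empty mult_zero_left)
    qed
  qed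
  finally show ?thesis .
qed

end

locale ergodic_partition_process = partition_process + ergodic_system

sublocale ergodic_partition_process \<subseteq> ergodic_process M f "atom P" P ..

lemma (in ergodic_partition_process) entropy_wrt_partition_eq:
  "entropy_wrt_partition M f P = entropy_rate"
  unfolding entropy_wrt_partition_def
proof (rule limI, rule Lim_transform_eventually[OF word_entropy_tendsto])
  show "\<forall>\<^sub>F n in sequentially. - (\<Sum>w\<in>words P n. word_prob w * ln (word_prob w)) / real n =
      partition_entropy M (dynamical_partition M f P n) / real n"
    using eventually_gt_at_top[of 0]
    by eventually_elim (simp add: partition_entropy_dynamical)
qed

section \<open>Hamming balls\<close>

definition hamming :: "'b list \<Rightarrow> 'b list \<Rightarrow> nat" where
  "hamming v w = card {i. i < length w \<and> v ! i \<noteq> w ! i}"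

lemma hamming_Cons: "hamming (a # v) (b # w) = (if a = b then 0 else 1) + hamming v w"
proof -
  have "{i. i < length (b # w) \<and> (a # v) ! i \<noteq> (b # w) ! i} =
      (if a = b then {} else {0}) \<union> Suc ` {i. i < length w \<and> v ! i \<noteq> w ! i}"
    (is "?L = ?R")
  proof (rule set_eqI)
    show "i \<in> ?L \<longleftrightarrow> i \<in> ?R" for i by (cases i) auto
  qed
  then show ?thesis
    by (simp add: hamming_def card_image)
qed

text \<open>The generating function of the Hamming distance factors over positions: a position
  contributes 1 for the matching letter and \<open>z\<close> for every other one.\<close>

lemma sum_hamming_le:
  assumes "finite A" "z \<ge> 0"
  shows "(\<Sum>v\<in>words A (length w). z ^ hamming v w) \<le> (1 + real (card A) * z) ^ length w"
proof (induction w)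
  case Nil
  then show ?case by (simp add: words_0 hamming_def)
next
  case (Cons b w)
  have "(\<Sum>v\<in>words A (length (b # w)). z ^ hamming v (b # w))
      = (\<Sum>a\<in>A. (if a = b then 1 else z) * (\<Sum>v\<in>words A (length w). z ^ hamming v w))"
    by (simp add: sum_words_Suc[OF assms(1)] hamming_Cons power_add sum_distrib_left if_distrib[of "(^) z"] cong: if_cong)
  also have "\<dots> = (\<Sum>a\<in>A. if a = b then 1 else z) * (\<Sum>v\<in>words A (length w). z ^ hamming v w)"
    by (simp only: sum_distrib_right)
  also have "\<dots> \<le> (1 + real (card A) * z) * (1 + real (card A) * z) ^ length w"
  proof (intro mult_mono Cons)
    have "(\<Sum>a\<in>A. if a = b then 1 else z) \<le> (\<Sum>a\<in>A. (if a = b then 1 else 0) + z)"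
      using assms by (intro sum_mono) auto
    also have "\<dots> \<le> 1 + real (card A) * z"
      using assms by (simp add: sum.distrib)
    finally show "(\<Sum>a\<in>A. if a = b then 1 else z) \<le> 1 + real (card A) * z" .
  qed (use assms in \<open>auto intro!: sum_nonneg\<close>)
  finally show ?case by simp
qed

text \<open>A Chernoff estimate: each word of the ball contributes at least \<open>z\<close> to the
  power \<open>b\<close> to the generating function. First a small \<open>z\<close> and then a small
  ratio of \<open>b\<close> to the length make the exponent a small multiple of the length.\<close>

lemma card_hamming_ball_le:
  assumes A: "finite A" and z: "0 < z" "z \<le> 1"
  shows "real (card {v \<in> words A (length w). real (hamming v w) \<le> b})
    \<le> exp (real (length w) * (real (card A) * z) + b * ln (1 / z))"
proof -
  let ?B = "{v \<in> words A (length w). real (hamming v w) \<le> b}" and ?t = "exp (- b * ln (1 / z))"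
  have "?t \<le> z ^ hamming v w" if "v \<in> ?B" for v
  proof -
    have "real (hamming v w) * ln (1 / z) \<le> b * ln (1 / z)"
      using that z by (intro mult_right_mono) auto
    then have "?t \<le> exp (real (hamming v w) * ln z)"
      using z by (simp add: ln_div)
    then show ?thesis using z by (simp add: exp_of_nat_mult)
  qed
  then have "real (card ?B) * ?t \<le> (\<Sum>v\<in>?B. z ^ hamming v w)"
    by (intro sum_bounded_below) auto
  also have "\<dots> \<le> (\<Sum>v\<in>words A (length w). z ^ hamming v w)"
    using z by (intro sum_mono2 finite_words A) auto
  also have "\<dots> \<le> (1 + real (card A) * z) ^ length w"
    using z by (intro sum_hamming_le A) auto
  also have "\<dots> \<le> exp (real (card A) * z) ^ length w"
    using z by (intro power_mono exp_ge_add_one_self add_nonneg_nonneg) auto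
  also have "\<dots> = exp (real (length w) * (real (card A) * z))"
    by (simp add: exp_of_nat_mult)
  finally have "real (card ?B) \<le> exp (real (length w) * (real (card A) * z)) / ?t"
    by (simp add: pos_le_divide_eq)
  then show ?thesis by (simp add: exp_add exp_minus divide_inverse)
qed

section \<open>Approximation by closed sets\<close>

text \<open>Induction over the sigma-algebra generated by the closed sets. Inner and outer
  approximations are carried along together because complements exchange them.\<close>

lemma closed_open_approximation:
  fixes M :: "'a::metric_space measure"
  assumes "finite_measure M" and M: "sets M = sets borel" and B: "B \<in> sets M" and e: "e > 0"
  shows "\<exists>C U. closed C \<and> open U \<and> C \<subseteq> B \<and> B \<subseteq> U \<and> measure M (U - C) < e"
proof -
  interpret finite_measure M by fact
  have cl: "C \<in> sets M" if "closed C" for C using that by (simp add: M)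
  have op: "U \<in> sets M" if "open U" for U using that by (simp add: M)
  have "B \<in> sigma_sets UNIV (Collect closed)"
    using B by (simp add: M borel_eq_closed)
  then show ?thesis using e
  proof (induction arbitrary: e rule: sigma_sets.induct)
    case (Basic S)
    then have S: "closed S" by simp
    \<comment> \<open>These open neighbourhoods shrink to the closure of \<open>S\<close>, which is
      \<open>S\<close>.\<close>
    define U where "U n = (\<Union>y\<in>S. ball y (1 / real (Suc n)))" for n
    have U: "open (U n)" for n by (auto simp: U_def)
    have "(\<lambda>n. measure M (U n - S)) \<longlonglongrightarrow> measure M (\<Inter>n. U n - S)"
    proof (rule finite_Lim_measure_decseq)
      show "range (\<lambda>n. U n - S) \<subseteq> sets M" using op[OF U] cl[OF S] by auto
      have "1 / real (Suc n) \<le> 1 / real (Suc m)" if "m \<le> n" for m n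
        using that by (simp add: field_simps)
      then show "decseq (\<lambda>n. U n - S)"
        unfolding decseq_def U_def by (meson Diff_mono SUP_mono' order_refl subset_ball)
    qed
    moreover have "(\<Inter>n. U n - S) = {}"
    proof (rule ccontr)
      assume "(\<Inter>n. U n - S) \<noteq> {}"
      then obtain x where x: "x \<notin> S" "\<And>n. x \<in> U n" by auto
      have "\<exists>y\<in>S. dist y x < r" if r: "r > 0" for r
      proof -
        obtain n where "1 / real (Suc n) < r"
          using reals_Archimedean[OF r] by (auto simp: inverse_eq_divide)
        then show ?thesis using x(2)[of n] by (force simp: U_def)
      qed
      then have "x \<in> closure S" by (simp add: closure_approachable)
      then show False using S x(1) by simp
    qed
    ultimately have "(\<lambda>n. measure M (U n - S)) \<longlonglongrightarrow> 0"
      by (simp only: measure_empty)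
    then have "\<forall>\<^sub>F n in sequentially. measure M (U n - S) < e"
      using Basic(2) by (rule order_tendstoD)
    then obtain n where "measure M (U n - S) < e"
      using eventually_happens by force
    moreover have "S \<subseteq> U n" by (auto simp: U_def)
    ultimately show ?case using S U by blast
  next
    case Empty
    then show ?case by (intro exI[of _ "{}"]) auto
  next
    case (Compl S)
    obtain C U where CU: "closed C" "open U" "C \<subseteq> S" "S \<subseteq> U" "measure M (U - C) < e"
      using Compl.IH[OF Compl.prems] by blast
    have "- C - - U = U - C" by auto
    then have "closed (- U)" "open (- C)" "- U \<subseteq> UNIV - S" "UNIV - S \<subseteq> - C" "measure M (- C - - U) < e"
      using CU by (auto simp only: closed_Compl open_Compl)
    then show ?case by blast
  next
    case (Union S)
    have "\<exists>C U. closed C \<and> open U \<and> C \<subseteq> S i \<and> S i \<subseteq> U \<and> measure M (U - C) < (e / 2) * (1 / 2) ^ Suc i" for i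
      using Union.IH[of "(e / 2) * (1 / 2) ^ Suc i" i] Union.prems by simp
    then obtain C U where CU: "\<And>i. closed (C i)" "\<And>i. open (U i)" "\<And>i. C i \<subseteq> S i" "\<And>i. S i \<subseteq> U i"
      "\<And>i. measure M (U i - C i) < (e / 2) * (1 / 2) ^ Suc i"
      by metis
    define V where "V = (\<Union>i. U i)"
    \<comment> \<open>A countable union of closed sets need not be closed, so a finite part is
      taken. The geometric errors add up to \<open>e / 2\<close>, which leaves room for truncating
      the union.\<close>
    define F where "F n = (\<Union>i<n. C i)" for n
    have F: "closed (F n)" for n unfolding F_def by (intro closed_UN) (auto simp: CU)
    have V: "open V" unfolding V_def using CU by auto
    have geo: "(\<lambda>i. (e / 2) * (1 / 2) ^ Suc i) sums (e / 2 * 1)"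
      by (intro sums_mult power_half_series)
    have summable: "summable (\<lambda>i. measure M (U i - C i))"
      by (rule summable_comparison_test'[OF sums_summable[OF geo], of 0])
         (use CU(5) in \<open>auto intro: less_imp_le\<close>)
    have sets_UC: "range (\<lambda>i. U i - C i) \<subseteq> sets M" using op[OF CU(2)] cl[OF CU(1)] by auto
    have "(\<Inter>n. V - F n) \<subseteq> (\<Union>i. U i - C i)"
      by (auto simp: V_def F_def)
    then have "measure M (\<Inter>n. V - F n) \<le> measure M (\<Union>i. U i - C i)"
      using sets_UC by (intro finite_measure_mono sets.countable_UN)
    also have "\<dots> \<le> (\<Sum>i. measure M (U i - C i))"
      by (intro finite_measure_subadditive_countably sets_UC summable)
    also have "\<dots> \<le> (\<Sum>i. (e / 2) * (1 / 2) ^ Suc i)"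
      using CU(5) by (intro suminf_le summable sums_summable[OF geo] less_imp_le)
    also have "\<dots> = e / 2" using sums_unique[OF geo] by simp
    finally have "measure M (\<Inter>n. V - F n) < e" using Union.prems by simp
    moreover have "(\<lambda>n. measure M (V - F n)) \<longlonglongrightarrow> measure M (\<Inter>n. V - F n)"
      using op[OF V] cl[OF F] by (intro finite_Lim_measure_decseq) (force simp: decseq_def F_def)+
    ultimately have "\<forall>\<^sub>F n in sequentially. measure M (V - F n) < e"
      by (intro order_tendstoD(2)) auto
    then obtain n where "measure M (V - F n) < e"
      using eventually_happens by force
    moreover have "F n \<subseteq> (\<Union>i. S i)" "(\<Union>i. S i) \<subseteq> V" 
      using subsetD[OF CU(3)] subsetD[OF CU(4)] unfolding F_def V_def by blast+
    ultimately show ?case by (intro exI[of _ "F n"] exI[of _ V] conjI F V)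
  qed
qed

lemma closed_inner_approximation:
  fixes M :: "'a::metric_space measure"
  assumes "finite_measure M" "sets M = sets borel" "B \<in> sets M" "e > 0"
  obtains C where "closed C" "C \<subseteq> B" "measure M (B - C) < e"
proof -
  interpret finite_measure M by fact
  obtain C U where CU: "closed C" "open U" "C \<subseteq> B" "B \<subseteq> U" "measure M (U - C) < e"
    using closed_open_approximation[OF assms] by blast
  then have "measure M (B - C) \<le> measure M (U - C)"
    using assms(2) by (intro finite_measure_mono) auto
  then show ?thesis using CU by (intro that[of C]) auto
qed

lemma compact_closed_separated:
  fixes S T :: "'a::metric_space set"
  assumes "compact S" "closed T" "S \<inter> T = {}"
  obtains r where "r > 0" "\<And>x y. x \<in> S \<Longrightarrow> y \<in> T \<Longrightarrow> r \<le> dist x y"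
proof (cases "S = {} \<or> T = {}")
  case True
  then show ?thesis using that[of 1] by auto
next
  case False
  have "continuous_on S (\<lambda>x. infdist x T)"
    by (intro continuous_on_infdist continuous_on_id)
  then obtain a where a: "a \<in> S" "\<And>x. x \<in> S \<Longrightarrow> infdist a T \<le> infdist x T"
    using continuous_attains_inf[OF assms(1), of "\<lambda>x. infdist x T"] False by metis
  have "infdist a T > 0"
    using a(1) assms(2,3) False infdist_pos_not_in_closed by fastforce
  then show ?thesis
    using that[of "infdist a T"] a(2) infdist_le by (meson order_trans)
qed

lemma finite_compact_separated:
  fixes K :: "'i \<Rightarrow> 'a::metric_space set"
  assumes I: "finite I" and K: "\<And>i. i \<in> I \<Longrightarrow> compact (K i)" and disj: "disjoint_family_on K I"
  obtains r where "r > 0" "\<And>i j x y. i \<in> I \<Longrightarrow> j \<in> I \<Longrightarrow> i \<noteq> j \<Longrightarrow> x \<in> K i \<Longrightarrow> y \<in> K j \<Longrightarrow> r \<le> dist x y"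
proof -
  have "\<exists>r>0. \<forall>x\<in>K i. \<forall>y\<in>K j. r \<le> dist x y" if "i \<in> I" "j \<in> I" "i \<noteq> j" for i j
    using compact_closed_separated[OF K[OF that(1)] compact_imp_closed[OF K[OF that(2)]]] that disj
    by (metis disjoint_family_on_def)
  then obtain r where r: "\<And>i j. i \<in> I \<Longrightarrow> j \<in> I \<Longrightarrow> i \<noteq> j \<Longrightarrow> r i j > (0::real) \<and> (\<forall>x\<in>K i. \<forall>y\<in>K j. r i j \<le> dist x y)"
    by metis
  \<comment> \<open>The element 1 keeps the minimum defined when there are no two distinct
    indices.\<close>
  define R where "R = insert 1 ((\<lambda>(i, j). r i j) ` {(i, j) \<in> I \<times> I. i \<noteq> j})"
  have R: "finite R" unfolding R_def using I by (auto intro: finite_subset[of _ "I \<times> I"])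
  have "Min R > 0" using R r by (subst Min_gr_iff) (auto simp: R_def)
  moreover have "Min R \<le> dist x y" if "i \<in> I" "j \<in> I" "i \<noteq> j" "x \<in> K i" "y \<in> K j" for i j x y
  proof -
    have "Min R \<le> r i j" using that R by (intro Min_le) (auto simp: R_def)
    then show ?thesis using r[OF that(1-3)] that by fastforce
  qed
  ultimately show ?thesis using that by blast
qed

section \<open>Growth rates of separated and spanning sets\<close>

lemma ecard_finite: "finite S \<Longrightarrow> ecard S = enat (card S)"
  by (simp add: ecard_def)

lemma ln_enat_mono: "a \<le> b \<Longrightarrow> ln_enat a \<le> ln_enat b"
  by (auto simp: ln_enat_def split: enat.splits)

lemma ln_enat_le: "real m \<le> exp r \<Longrightarrow> ln_enat (enat m) \<le> ereal r"
  using ln_le_cancel_iff[of "real m" "exp r"] by (simp add: ln_enat_def)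

lemma ln_enat_ge: "exp r \<le> real m \<Longrightarrow> ereal r \<le> ln_enat (enat m)"
  using exp_gt_zero[of r] by (cases "m = 0") (auto simp: ln_enat_def ln_ge_iff)

lemma dist_on_leD:
  assumes "dist_on f \<Lambda> x y \<le> \<epsilon>" "finite \<Lambda>" "j \<in> \<Lambda>"
  shows "dist ((f ^^ j) x) ((f ^^ j) y) \<le> \<epsilon>"
  using assms unfolding dist_on_def by (subst (asm) Max_le_iff) auto

lemma dist_on_commute: "dist_on f \<Lambda> x y = dist_on f \<Lambda> y x"
  by (simp add: dist_on_def dist_commute)

lemma full_index_set: "{..<n} \<in> index_sets n m"
  by (simp add: index_sets_def)

lemma card_mistakes_le:
  assumes "\<Lambda> \<in> index_sets n m" "dist_on f \<Lambda> x y \<le> \<epsilon>"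
  shows "card {j. j < n \<and> dist ((f ^^ j) x) ((f ^^ j) y) > \<epsilon>} \<le> m"
proof -
  have \<Lambda>: "\<Lambda> \<subseteq> {..<n}" "card \<Lambda> \<ge> n - m" "finite \<Lambda>"
    using assms(1) finite_subset by (auto simp: index_sets_def)
  have "{j. j < n \<and> dist ((f ^^ j) x) ((f ^^ j) y) > \<epsilon>} \<subseteq> {..<n} - \<Lambda>"
    using dist_on_leD[OF assms(2) \<Lambda>(3)] by force
  then have "card {j. j < n \<and> dist ((f ^^ j) x) ((f ^^ j) y) > \<epsilon>} \<le> card ({..<n} - \<Lambda>)"
    by (rule card_mono[rotated]) auto
  also have "\<dots> = n - card \<Lambda>" using \<Lambda> by (simp add: card_Diff_subset)
  finally show ?thesis using \<Lambda>(2) by linarith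
qed

text \<open>If separated sets have bounded size, one of maximal size is spanning: a point of
  \<open>Z\<close> that it misses could be added to it.\<close>

lemma span_number_le_sep_number:
  assumes "g n \<epsilon> < n" "\<epsilon> \<ge> 0"
  shows "span_number f g n Z \<epsilon> \<le> sep_number f g n Z \<epsilon>"
proof (cases "sep_number f g n Z \<epsilon>")
  case infinity
  then show ?thesis by simp
next
  case (enat m)
  have bound: "finite S \<and> card S \<le> m" if "mistake_separated f g n \<epsilon> Z S" for S
  proof -
    have "ecard S \<le> enat m"
      unfolding enat[symmetric] sep_number_def using that by (intro SUP_upper) auto
    then show ?thesis by (auto simp: ecard_def split: if_splits)
  qed
  have "mistake_separated f g n \<epsilon> Z {}" by (simp add: mistake_separated_def)
  then obtain S where S: "mistake_separated f g n \<epsilon> Z S"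
    and max: "\<And>T. mistake_separated f g n \<epsilon> Z T \<Longrightarrow> card T \<le> card S"
    using ex_has_greatest_nat[of "mistake_separated f g n \<epsilon> Z" "{}" card "Suc m"] bound
    by (auto simp: less_Suc_eq_le)
  have "mistake_spanning f g n \<epsilon> Z S"
    unfolding mistake_spanning_def
  proof (intro conjI ballI)
    show SZ: "S \<subseteq> Z" using S by (simp add: mistake_separated_def)
    fix x assume x: "x \<in> Z"
    show "\<exists>y\<in>S. \<exists>\<Lambda>\<in>index_sets n (g n \<epsilon>). dist_on f \<Lambda> x y \<le> \<epsilon>"
    proof (rule ccontr)
      assume *: "\<not> ?thesis"
      \<comment> \<open>Here \<open>g n \<epsilon> < n\<close> gives \<open>n > 0\<close>, so that
        the maximum runs over a nonempty set.\<close>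
      have "dist_on f {..<n} x x = 0" using assms(1) by (simp add: dist_on_def image_constant_conv lessThan_empty_iff)
      then have "x \<notin> S" using * full_index_set[of n "g n \<epsilon>"] assms(2) by fastforce
      moreover have "mistake_separated f g n \<epsilon> Z (insert x S)"
        unfolding mistake_separated_def
      proof (intro conjI ballI impI)
        show "insert x S \<subseteq> Z" using x SZ by simp
        fix \<Lambda> u v assume u: "\<Lambda> \<in> index_sets n (g n \<epsilon>)" "u \<in> insert x S" "v \<in> insert x S" "u \<noteq> v"
        have far: "dist_on f \<Lambda> x w > \<epsilon>" if "w \<in> S" for w
          using * u(1) that not_le by blast
        show "\<epsilon> < dist_on f \<Lambda> u v"
          using u S far[of u] far[of v] by (auto simp: dist_on_commute[of f \<Lambda> u x] mistake_separated_def)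
      qed
      ultimately show False
        using max[of "insert x S"] bound[OF S] by simp
    qed
  qed
  then have "span_number f g n Z \<epsilon> \<le> ecard S"
    unfolding span_number_def by (intro INF_lower) auto
  also have "\<dots> \<le> sep_number f g n Z \<epsilon>"
    unfolding sep_number_def using S by (intro SUP_upper) auto
  finally show ?thesis .
qed

lemma mistake_function_tendsto:
  assumes "mistake_function \<epsilon>0 g" "\<epsilon> > 0"
  shows "(\<lambda>n. real (g n \<epsilon>) / real n) \<longlonglongrightarrow> 0"
proof (cases "\<epsilon> \<le> \<epsilon>0")
  case True
  then show ?thesis using assms by (auto simp: mistake_function_def)
next
  case False
  then have "g n \<epsilon> = g n \<epsilon>0" for n using assms by (auto simp: mistake_function_def)
  then show ?thesis using assms by (simp add: mistake_function_def)
qed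

lemma mistake_function_less:
  assumes "mistake_function \<epsilon>0 g" "\<epsilon> > 0" "\<alpha> > 0"
  shows "\<forall>\<^sub>F n in sequentially. real (g n \<epsilon>) < \<alpha> * real n"
  using order_tendstoD(2)[OF mistake_function_tendsto[OF assms(1,2)] assms(3)] eventually_gt_at_top[of 0]
  by eventually_elim (simp add: field_simps)

lemma span_rate_le_sep_rate:
  assumes "mistake_function \<epsilon>0 g" "\<epsilon> > 0"
  shows "\<forall>\<^sub>F n in sequentially. span_rate M f \<gamma> g \<epsilon> n \<le> sep_rate M f \<gamma> g \<epsilon> n"
  using mistake_function_less[OF assms zero_less_one] eventually_gt_at_top[of 0]
proof eventually_elim
  case (elim n)
  then have "span_number f g n Z \<epsilon> \<le> sep_number f g n Z \<epsilon>" for Z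
    using assms(2) by (intro span_number_le_sep_number) auto
  then have "(INF Z\<in>large_sets M \<gamma>. span_number f g n Z \<epsilon>) \<le> (INF Z\<in>large_sets M \<gamma>. sep_number f g n Z \<epsilon>)"
    by (intro INF_mono) auto
  then show ?case
    unfolding span_rate_def sep_rate_def using elim by (intro ereal_divide_right_mono ln_enat_mono) auto
qed

section \<open>Bounds for the rates from a single partition\<close>

locale ergodic_borel_process = ergodic_partition_process M f P
  for M :: "'a::metric_space measure" and f :: "'a \<Rightarrow> 'a" and P :: "'a set set" +
  assumes sets_M: "sets M = sets borel"
begin

lemma space_M [simp]: "space M = UNIV"
  using sets_eq_imp_space_eq[OF sets_M] by simp

lemma partition_on_P: "partition_on UNIV P"
  using partition by (simp add: finite_measurable_partition_def)

lemma mem_atom: "atom P x \<in> P" "x \<in> atom P x"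
  using atom_in[OF partition_on_P] by auto

text \<open>Let \<open>Z\<close> consist of the points with typical names. Points with equal names
  stay \<open>\<epsilon>\<close>-close at all times below \<open>n\<close>, so they are not
  separated for the full index set, which is admissible for every \<open>g\<close>. A separated
  subset of \<open>Z\<close> thus injects into \<open>W\<close>.\<close>

lemma sep_rate_le:
  assumes small: "\<And>B x y. B \<in> P \<Longrightarrow> x \<in> B \<Longrightarrow> y \<in> B \<Longrightarrow> dist x y \<le> \<epsilon>"
    and "\<gamma> > 0" "\<delta> > 0"
  shows "\<forall>\<^sub>F n in sequentially. sep_rate M f \<gamma> g \<epsilon> n \<le> ereal (entropy_rate + \<delta>)"
  using names_concentrated[OF \<open>\<delta> > 0\<close> \<open>\<gamma> > 0\<close>] eventually_gt_at_top[of 0]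
proof eventually_elim
  case (elim n)
  obtain W where W: "W \<subseteq> words P n" "real (card W) \<le> exp (real n * (entropy_rate + \<delta>))"
    "prob {x \<in> space M. name n x \<in> W} \<ge> 1 - \<gamma>"
    using elim(1) by blast
  have finW: "finite W" using W(1) finite_words[OF finite_A] finite_subset by blast
  define Z where "Z = {x \<in> space M. name n x \<in> W}"
  have Z: "Z \<in> large_sets M \<gamma>"
    unfolding large_sets_def Z_def using W(3) sets_name[of "\<lambda>w. w \<in> W" n] by simp
  have "ecard S \<le> enat (card W)" if S: "mistake_separated f g n \<epsilon> Z S" for S
  proof -
    have "inj_on (name n) S"
    proof (rule inj_onI, rule ccontr)
      fix x y assume xy: "x \<in> S" "y \<in> S" "name n x = name n y" "x \<noteq> y"
      have "dist ((f ^^ j) x) ((f ^^ j) y) \<le> \<epsilon>" if "j < n" for j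
      proof -
        have "atom P ((f ^^ j) x) = atom P ((f ^^ j) y)"
          using xy(3) that by (simp add: name_eq_iff)
        then show ?thesis
          using small[OF mem_atom(1)[of "(f ^^ j) x"]] mem_atom(2) by metis
      qed
      then have "dist_on f {..<n} x y \<le> \<epsilon>"
        unfolding dist_on_def using elim(2) by (subst Max_le_iff) auto
      moreover have "dist_on f {..<n} x y > \<epsilon>"
        using S full_index_set xy unfolding mistake_separated_def by blast
      ultimately show False by simp
    qed
    moreover have "name n ` S \<subseteq> W"
      using S by (auto simp: mistake_separated_def Z_def)
    ultimately show ?thesis
      using finW card_inj_on_le inj_on_finite by (metis ecard_finite enat_ord_simps(1))
  qed
  then have "sep_number f g n Z \<epsilon> \<le> enat (card W)"
    unfolding sep_number_def by (intro SUP_least) auto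
  then have "(INF Z\<in>large_sets M \<gamma>. sep_number f g n Z \<epsilon>) \<le> enat (card W)"
    by (rule INF_lower2[OF Z])
  then have "ln_enat (INF Z\<in>large_sets M \<gamma>. sep_number f g n Z \<epsilon>) \<le> ereal (real n * (entropy_rate + \<delta>))"
    by (rule order_trans[OF ln_enat_mono ln_enat_le[OF W(2)]])
  then show ?case
    unfolding sep_rate_def using elim(2) by (subst ereal_divide_le_pos) auto
qed

text \<open>At a time when both orbits are in \<open>K\<close> and neither is a mistake relative to
  \<open>z\<close>, they are within \<open>2 * \<epsilon>\<close> of each other and hence in the
  same atom. Every differing letter is charged to a visit outside \<open>K\<close> or to a
  mistake.\<close>

lemma hamming_name_le:
  assumes K: "\<And>u v. u \<in> K \<Longrightarrow> v \<in> K \<Longrightarrow> dist u v \<le> 2 * \<epsilon> \<Longrightarrow> atom P u = atom P v"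
    and x: "\<Lambda> \<in> index_sets n m" "dist_on f \<Lambda> x z \<le> \<epsilon>"
    and y: "\<Lambda>' \<in> index_sets n m" "dist_on f \<Lambda>' y z \<le> \<epsilon>"
  shows "hamming (name n x) (name n y) \<le>
    card {i. i < n \<and> (f ^^ i) x \<in> - K} + card {i. i < n \<and> (f ^^ i) y \<in> - K} + 2 * m"
proof -
  let ?D = "\<lambda>x. {i. i < n \<and> dist ((f ^^ i) x) ((f ^^ i) z) > \<epsilon>}"
  let ?V = "\<lambda>x. {i. i < n \<and> (f ^^ i) x \<in> - K}"
  have "{i. i < length (name n y) \<and> name n x ! i \<noteq> name n y ! i} \<subseteq> (?V x \<union> ?V y) \<union> (?D x \<union> ?D y)"
  proof
    fix i assume "i \<in> {i. i < length (name n y) \<and> name n x ! i \<noteq> name n y ! i}"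
    then have i: "i < n" "atom P ((f ^^ i) x) \<noteq> atom P ((f ^^ i) y)"
      by (auto simp: name_nth)
    show "i \<in> (?V x \<union> ?V y) \<union> (?D x \<union> ?D y)"
    proof (rule ccontr)
      assume "i \<notin> (?V x \<union> ?V y) \<union> (?D x \<union> ?D y)"
      then have "(f ^^ i) x \<in> K" "(f ^^ i) y \<in> K" "dist ((f ^^ i) x) ((f ^^ i) z) \<le> \<epsilon>"
        "dist ((f ^^ i) y) ((f ^^ i) z) \<le> \<epsilon>"
        using i(1) by auto
      then show False
        using i(2) K dist_triangle2[of "(f ^^ i) x" "(f ^^ i) y" "(f ^^ i) z"] by force
    qed
  qed
  then have "hamming (name n x) (name n y) \<le> card ((?V x \<union> ?V y) \<union> (?D x \<union> ?D y))"
    unfolding hamming_def by (rule card_mono[rotated]) auto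
  also have "\<dots> \<le> (card (?V x) + card (?V y)) + (card (?D x) + card (?D y))"
    by (intro order_trans[OF card_Un_le] add_mono card_Un_le)
  finally show ?thesis
    using card_mistakes_le[OF x] card_mistakes_le[OF y] by simp
qed

text \<open>After removing from \<open>Z\<close> the orbits that leave \<open>K\<close> too often
  (\<open>E1\<close>) and the heavy names (\<open>E2\<close>), the remaining light names number at
  least \<open>2 * \<kappa> * exp (c * n)\<close>. A spanning point accounts for at most
  \<open>exp (2 * \<delta> * n)\<close> of them, a Hamming ball. The last \<open>\<delta>\<close>
  absorbs \<open>2 * \<kappa>\<close>.\<close>

lemma span_rate_ge:
  assumes K: "K \<in> sets M" "\<And>u v. u \<in> K \<Longrightarrow> v \<in> K \<Longrightarrow> dist u v \<le> 2 * \<epsilon> \<Longrightarrow> atom P u = atom P v"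
    and \<gamma>: "\<gamma> < 1" and \<delta>: "\<delta> > 0" and z: "0 < z" "z \<le> 1" "real (card P) * z \<le> \<delta>"
    and \<tau>: "\<tau> > 0" "4 * \<tau> * ln (1 / z) \<le> \<delta>" "prob (- K) \<le> \<tau> * (1 - \<gamma>) / 4"
    and g: "\<forall>\<^sub>F n in sequentially. real (g n \<epsilon>) < \<tau> * real n"
  shows "\<forall>\<^sub>F n in sequentially. ereal (entropy_rate - 4 * \<delta>) \<le> span_rate M f \<gamma> g \<epsilon> n"
proof -
  define c where "c = entropy_rate - \<delta>"
  \<comment> \<open>\<open>Z\<close> has measure at least \<open>4 * \<kappa>\<close>, and
    \<open>E1\<close> and \<open>E2\<close> take at most one \<open>\<kappa>\<close> each.\<close>
  define \<kappa> where "\<kappa> = (1 - \<gamma>) / 4"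
  have \<kappa>: "\<kappa> > 0" using \<gamma> by (simp add: \<kappa>_def)
  have "\<forall>\<^sub>F n in sequentially. prob {x \<in> space M. word_prob (name n x) \<ge> exp (- c * real n)} < \<kappa>"
    using \<delta> \<kappa> by (intro order_tendstoD(2)[OF prob_heavy_words_tendsto_0]) (auto simp: c_def)
  moreover have "\<forall>\<^sub>F n in sequentially. 1 \<le> 2 * \<kappa> * exp (\<delta> * real n)"
    using \<delta> \<kappa> by real_asymp
  ultimately show ?thesis
    using g eventually_gt_at_top[of 0]
  proof eventually_elim
    case (elim n)
    define V where "V x = card {i. i < n \<and> (f ^^ i) x \<in> - K}" for x
    define E1 where "E1 = {x \<in> space M. real (V x) \<ge> \<tau> * real n}"
    define E2 where "E2 = {x \<in> space M. word_prob (name n x) \<ge> exp (- c * real n)}"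
    have K': "- K \<in> sets M" using sets.compl_sets[OF K(1)] by (simp add: Compl_eq_Diff_UNIV)
    have E1: "E1 \<in> sets M"
      unfolding E1_def V_def using K' by measurable
    have "prob E1 \<le> prob (- K) / \<tau>"
      unfolding E1_def V_def by (rule prob_visits_le[OF K' \<tau>(1) elim(4)])
    also have "\<dots> \<le> \<kappa>" using \<tau> by (simp add: \<kappa>_def field_simps)
    finally have pE1: "prob E1 \<le> \<kappa>" .
    have E2: "E2 \<in> sets M" unfolding E2_def by (rule sets_name)
    have pE2: "prob E2 \<le> \<kappa>" using elim(1) by (simp add: E2_def)
    have card_S: "exp (real n * (entropy_rate - 4 * \<delta>)) \<le> real (card S)"
      if Z: "Z \<in> large_sets M \<gamma>" and S: "mistake_spanning f g n \<epsilon> Z S" "finite S" for Z S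
    proof -
      define Z' where "Z' = Z - (E1 \<union> E2)"
      have Zs: "Z \<in> sets M" "prob Z \<ge> 4 * \<kappa> " using Z by (auto simp: large_sets_def \<kappa>_def)
      have "prob Z \<le> prob (Z' \<union> (E1 \<union> E2))"
        using Zs E1 E2 by (intro finite_measure_mono) (auto simp: Z'_def)
      also have "\<dots> \<le> prob Z' + (prob E1 + prob E2)"
        using Zs E1 E2 by (intro order_trans[OF measure_Un_le] add_left_mono measure_Un_le) (auto simp: Z'_def)
      finally have pZ': "2 * \<kappa> \<le> prob Z'" using Zs pE1 pE2 by linarith
      have card_le: "real (card (name n ` Z')) \<le> real (card S) * exp (2 * \<delta> * real n)"
      proof -
        define T where "T y = {x \<in> Z'. \<exists>\<Lambda>\<in>index_sets n (g n \<epsilon>). dist_on f \<Lambda> x y \<le> \<epsilon>}" for y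
        have T: "real (card (name n ` T y)) \<le> exp (2 * \<delta> * real n)" for y
        proof (cases "T y = {}")
          case False
          \<comment> \<open>The Hamming ball is centred at the name of a point \<open>x0\<close> of
            \<open>Z'\<close>, since the orbit of the spanning point \<open>y\<close> itself may
            leave \<open>K\<close> often. The radius combines two visit counts and twice the
            mistakes, each count below \<open>\<tau> * n\<close>.\<close>
          then obtain x0 where x0: "x0 \<in> T y" by auto
          have "name n ` T y \<subseteq> {v \<in> words P (length (name n x0)). real (hamming v (name n x0)) \<le> 4 * \<tau> * real n}"
          proof clarify
            fix x assume x: "x \<in> T y"
            have "hamming (name n x) (name n x0) \<le> V x + V x0 + 2 * g n \<epsilon>"
              using x x0 hamming_name_le[OF K(2)] unfolding T_def V_def by blast
            moreover have "real (V x) < \<tau> * real n" "real (V x0) < \<tau> * real n"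
              using x x0 by (auto simp: T_def Z'_def E1_def)
            ultimately have "real (hamming (name n x) (name n x0)) \<le> 4 * \<tau> * real n"
              using elim(3) by linarith
            then show "name n x \<in> words P (length (name n x0)) \<and> real (hamming (name n x) (name n x0)) \<le> 4 * \<tau> * real n"
              using name_in_words by simp
          qed
          then have "real (card (name n ` T y)) \<le>
              real (card {v \<in> words P (length (name n x0)). real (hamming v (name n x0)) \<le> 4 * \<tau> * real n})"
            by (intro of_nat_mono card_mono) (auto simp: finite_words finite_A)
          also have "\<dots> \<le> exp (real n * (real (card P) * z) + (4 * \<tau> * real n) * ln (1 / z))"
            using card_hamming_ball_le[OF finite_A z(1,2), of "name n x0" "4 * \<tau> * real n"] by simp
          also have "(4 * \<tau> * real n) * ln (1 / z) = real n * (4 * \<tau> * ln (1 / z))"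
            by simp
          also have "exp (real n * (real (card P) * z) + real n * (4 * \<tau> * ln (1 / z))) \<le> exp (real n * \<delta> + real n * \<delta>)"
            unfolding exp_le_cancel_iff using z \<tau> by (intro add_mono mult_left_mono) auto
          also have "\<dots> = exp (2 * \<delta> * real n)" by (simp add: mult.commute mult.left_commute)
          finally show ?thesis .
        qed simp
        have "Z' \<subseteq> (\<Union>y\<in>S. T y)"
          using S(1) unfolding mistake_spanning_def T_def Z'_def by blast
        then have "name n ` Z' \<subseteq> (\<Union>y\<in>S. name n ` T y)" by blast
        moreover have "finite (name n ` T y)" for y
          using name_in_words by (intro finite_subset[OF _ finite_words[OF finite_A, of n]]) auto
        ultimately have "card (name n ` Z') \<le> card (\<Union>y\<in>S. name n ` T y)"
          using S(2) by (intro card_mono) auto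
        also have "\<dots> \<le> (\<Sum>y\<in>S. card (name n ` T y))"
          by (rule card_UN_le[OF S(2)])
        finally have "real (card (name n ` Z')) \<le> (\<Sum>y\<in>S. real (card (name n ` T y)))"
          by (metis of_nat_le_iff of_nat_sum)
        also have "\<dots> \<le> real (card S) * exp (2 * \<delta> * real n)"
          by (rule sum_bounded_above) (rule T)
        finally show ?thesis .
      qed
      have "prob Z' \<le> prob {x \<in> space M. name n x \<in> name n ` Z'}"
        by (intro finite_measure_mono sets_name) auto
      also have "\<dots> = (\<Sum>w | w \<in> words P n \<and> w \<in> name n ` Z'. word_prob w)"
        by (rule prob_name)
      also have "{w. w \<in> words P n \<and> w \<in> name n ` Z'} = name n ` Z'"
        using name_in_words by auto
      also have "(\<Sum>w\<in>name n ` Z'. word_prob w) \<le> real (card (name n ` Z')) * exp (- c * real n)"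
        by (rule sum_bounded_above) (auto simp: Z'_def E2_def)
      also have "\<dots> \<le> (real (card S) * exp (2 * \<delta> * real n)) * exp (- c * real n)"
        by (rule mult_right_mono[OF card_le]) simp
      also have "\<dots> = real (card S) * exp (- (real n * (entropy_rate - 3 * \<delta>)))"
        by (simp add: mult.assoc exp_add[symmetric] c_def algebra_simps)
      finally have "2 * \<kappa> \<le> real (card S) * exp (- (real n * (entropy_rate - 3 * \<delta>)))"
        using pZ' by linarith
      then have "2 * \<kappa> * exp (real n * (entropy_rate - 3 * \<delta>))
          \<le> (real (card S) * exp (- (real n * (entropy_rate - 3 * \<delta>)))) * exp (real n * (entropy_rate - 3 * \<delta>))"
        by (rule mult_right_mono) simp
      then have *: "2 * \<kappa> * exp (real n * (entropy_rate - 3 * \<delta>)) \<le> real (card S)"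
        by (simp only: mult.assoc exp_add[symmetric]) simp
      have "exp (real n * (entropy_rate - 4 * \<delta>)) * 1
          \<le> exp (real n * (entropy_rate - 4 * \<delta>)) * (2 * \<kappa> * exp (\<delta> * real n))"
        using elim(2) by (intro mult_left_mono) auto
      also have "\<dots> = 2 * \<kappa> * exp (real n * (entropy_rate - 3 * \<delta>))"
        by (simp add: exp_add[symmetric] algebra_simps)
      finally show ?thesis using * by simp
    qed
    have "ereal (real n * (entropy_rate - 4 * \<delta>)) \<le> ln_enat (INF Z\<in>large_sets M \<gamma>. span_number f g n Z \<epsilon>)"
    proof (cases "INF Z\<in>large_sets M \<gamma>. span_number f g n Z \<epsilon>")
      case infinity
      then show ?thesis by (simp add: ln_enat_def)
    next
      case (enat m)
      \<comment> \<open>The strict bound by \<open>Suc m\<close> yields an actual \<open>Z\<close>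
        and a spanning set with at most \<open>m\<close> elements.\<close>
      then have "(INF Z\<in>large_sets M \<gamma>. span_number f g n Z \<epsilon>) < enat (Suc m)"
        by simp
      then obtain Z S where ZS: "Z \<in> large_sets M \<gamma>" "mistake_spanning f g n \<epsilon> Z S" "ecard S < enat (Suc m)"
        unfolding span_number_def INF_less_iff by auto
      then have "finite S" "card S \<le> m" by (auto simp: ecard_def split: if_splits)
      then have "exp (real n * (entropy_rate - 4 * \<delta>)) \<le> real m"
        using card_S[OF ZS(1,2)] by linarith
      then show ?thesis unfolding enat by (rule ln_enat_ge)
    qed
    then show ?case
      unfolding span_rate_def using elim(4) by (subst ereal_le_divide_pos) auto
  qed
qed

text \<open>The radius \<open>r\<close> is fixed before \<open>\<epsilon>\<close> and
  \<open>g\<close>; this is the source of the uniformity in the mistake function. It comes from the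
  mutual distance of closed subsets of the atoms, halved because two points
  \<open>\<epsilon>\<close>-close to a third are only \<open>2 * \<epsilon>\<close>-close.\<close>

lemma eventually_span_rate_ge:
  assumes compact: "compact (UNIV :: 'a set)" and \<gamma>: "\<gamma> < 1" and a: "a < entropy_rate"
  obtains r where "r > 0"
    "\<And>\<epsilon> \<epsilon>0 g. 0 < \<epsilon> \<Longrightarrow> \<epsilon> < r \<Longrightarrow> mistake_function \<epsilon>0 g \<Longrightarrow>
       \<forall>\<^sub>F n in sequentially. ereal a \<le> span_rate M f \<gamma> g \<epsilon> n"
proof -
  define \<delta> where "\<delta> = (entropy_rate - a) / 4"
  have \<delta>: "\<delta> > 0" "entropy_rate - 4 * \<delta> = a" using a by (auto simp: \<delta>_def field_simps)
  define k where "k = real (card P)"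
  have k: "k \<ge> 1" using card_A_pos by (auto simp: k_def)
  \<comment> \<open>Order of choices: \<open>z\<close> makes the first term of the Hamming exponent
    at most \<open>\<delta>\<close>, then \<open>\<tau>\<close> does so for the second, then
    \<open>e\<close> bounds the mass outside \<open>K\<close> so that Markov's inequality with
    \<open>\<tau>\<close> gives \<open>(1 - \<gamma>) / 4\<close>.\<close>
  define z where "z = min 1 (\<delta> / k)"
  have z: "0 < z" "z \<le> 1" "k * z \<le> \<delta>"
    using \<delta> k by (auto simp: z_def min_def field_simps)
  define l where "l = ln (1 / z)"
  have l: "l \<ge> 0" using z by (simp add: l_def)
  define \<tau> where "\<tau> = \<delta> / (4 * (l + 1))"
  have \<tau>: "\<tau> > 0" "4 * \<tau> * l \<le> \<delta>"
    using \<delta> l by (auto simp: \<tau>_def field_simps)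
  define e where "e = \<tau> * (1 - \<gamma>) / 4"
  have e: "e > 0" using \<tau> \<gamma> by (simp add: e_def)
  have fin: "finite P" and setsP: "P \<subseteq> sets M"
    using partition by (auto simp: finite_measurable_partition_def)
  have "\<exists>C. closed C \<and> C \<subseteq> B \<and> prob (B - C) < e / k" if B: "B \<in> P" for B
  proof -
    have "e / k > 0" using e k by simp
    then obtain C where "closed C" "C \<subseteq> B" "prob (B - C) < e / k"
      by (rule closed_inner_approximation[OF finite_measure_axioms sets_M subsetD[OF setsP B]])
    then show ?thesis by blast
  qed
  then obtain C where C: "\<And>B. B \<in> P \<Longrightarrow> closed (C B)" "\<And>B. B \<in> P \<Longrightarrow> C B \<subseteq> B"
    "\<And>B. B \<in> P \<Longrightarrow> prob (B - C B) < e / k"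
    by metis
  have CM: "C B \<in> sets M" if "B \<in> P" for B using C(1)[OF that] by (simp add: sets_M)
  have "disjoint_family_on C P"
    using partition_on_P C(2) unfolding disjoint_family_on_def partition_on_def disjoint_def by blast
  moreover have "compact (C B)" if "B \<in> P" for B
    using compact_Int_closed[OF compact C(1)[OF that]] by simp
  ultimately obtain r where r: "r > 0"
    "\<And>B B' x y. B \<in> P \<Longrightarrow> B' \<in> P \<Longrightarrow> B \<noteq> B' \<Longrightarrow> x \<in> C B \<Longrightarrow> y \<in> C B' \<Longrightarrow> r \<le> dist x y"
    using finite_compact_separated[OF fin, of C] by blast
  define K where "K = (\<Union>B\<in>P. C B)"
  have K: "K \<in> sets M" unfolding K_def using fin CM by (intro sets.finite_UN) auto
  have "- K \<subseteq> (\<Union>B\<in>P. B - C B)"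
    using mem_atom by (auto simp: K_def)
  then have "prob (- K) \<le> prob (\<Union>B\<in>P. B - C B)"
    using fin CM setsP by (intro finite_measure_mono sets.finite_UN) auto
  also have "\<dots> \<le> (\<Sum>B\<in>P. prob (B - C B))"
    using fin CM setsP by (intro measure_UNION_le) auto
  also have "\<dots> \<le> (\<Sum>B\<in>P. e / k)"
    using C(3) by (intro sum_mono) (auto intro: less_imp_le)
  also have "\<dots> = e" using k by (simp add: k_def)
  finally have pK: "prob (- K) \<le> \<tau> * (1 - \<gamma>) / 4" by (simp add: e_def)
  show ?thesis
  proof (rule that[of "r / 2"])
    show "r / 2 > 0" using r by simp
    fix \<epsilon> \<epsilon>0 :: real and g
    assume \<epsilon>: "0 < \<epsilon>" "\<epsilon> < r / 2" and g: "mistake_function \<epsilon>0 g"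
    have "atom P u = atom P v" if uv: "u \<in> K" "v \<in> K" "dist u v \<le> 2 * \<epsilon>" for u v
    proof -
      obtain B B' where B: "B \<in> P" "u \<in> C B" "B' \<in> P" "v \<in> C B'"
        using uv unfolding K_def by blast
      then have "B = B'" using r(2)[of B B' u v] uv(3) \<epsilon>(2) by force
      then show ?thesis
        using atom_eq[OF partition_on_P] B C(2) by (metis subsetD)
    qed
    then have "\<forall>\<^sub>F n in sequentially. ereal (entropy_rate - 4 * \<delta>) \<le> span_rate M f \<gamma> g \<epsilon> n"
      using K \<gamma> \<delta>(1) z \<tau> pK mistake_function_less[OF g \<epsilon>(1) \<tau>(1)]
      by (intro span_rate_ge[of K \<epsilon> \<gamma> \<delta> z \<tau>]) (auto simp: k_def l_def)
    then show "\<forall>\<^sub>F n in sequentially. ereal a \<le> span_rate M f \<gamma> g \<epsilon> n"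
      by (simp add: \<delta>(2))
  qed
qed

end

section \<open>The entropy formula\<close>

text \<open>Cover the space by finitely many balls of radius \<open>\<epsilon> / 2\<close> and group
  points by the set of balls containing them; points of one atom share a ball.\<close>

lemma fine_partition_exists:
  fixes M :: "'a::metric_space measure"
  assumes "compact (UNIV :: 'a set)" "sets M = sets borel" "\<epsilon> > 0"
  obtains P where "finite_measurable_partition M P"
    "\<And>B x y. B \<in> P \<Longrightarrow> x \<in> B \<Longrightarrow> y \<in> B \<Longrightarrow> dist x y \<le> \<epsilon>"
proof -
  obtain C where C: "finite C" "(UNIV :: 'a set) \<subseteq> (\<Union>c\<in>C. ball c (\<epsilon> / 2))"
  proof (rule compactE_image[OF assms(1), of UNIV "\<lambda>c. ball c (\<epsilon> / 2)"])
    show "UNIV \<subseteq> (\<Union>c. ball c (\<epsilon> / 2))" using assms(3) by auto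
  qed auto
  define \<phi> where "\<phi> x = {c \<in> C. dist c x < \<epsilon> / 2}" for x
  define P where "P = (\<lambda>S. \<phi> -` {S}) ` range \<phi>"
  have space: "space M = UNIV" using sets_eq_imp_space_eq[OF assms(2)] by simp
  have "finite (range \<phi>)"
    using C(1) by (intro finite_subset[of "range \<phi>" "Pow C"]) (auto simp: \<phi>_def)
  moreover have "\<phi> -` {S} \<in> sets M" if "S \<in> range \<phi>" for S
  proof -
    have "S \<subseteq> C" using that by (auto simp: \<phi>_def)
    then have "\<phi> x = S \<longleftrightarrow> (\<forall>c\<in>C. dist c x < \<epsilon> / 2 \<longleftrightarrow> c \<in> S)" for x
      unfolding \<phi>_def by blast
    then have "\<phi> -` {S} = {x \<in> space M. \<forall>c\<in>C. x \<in> (if c \<in> S then ball c (\<epsilon> / 2) else - ball c (\<epsilon> / 2))}"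
      by (auto simp: space)
    also have "\<dots> \<in> sets M"
      by (intro sets.sets_Collect_finite_All C) (auto simp: space assms(2))
    finally show ?thesis .
  qed
  moreover have "partition_on UNIV P"
    by (rule partition_onI) (auto simp: P_def disjnt_def)
  ultimately have "finite_measurable_partition M P"
    by (auto simp: finite_measurable_partition_def P_def space)
  moreover have "dist x y \<le> \<epsilon>" if "B \<in> P" "x \<in> B" "y \<in> B" for B x y
  proof -
    have "\<phi> x = \<phi> y" using that by (auto simp: P_def)
    moreover obtain c where "c \<in> C" "dist c x < \<epsilon> / 2"
      using subsetD[OF C(2) UNIV_I, of x] by auto
    ultimately have "dist c y < \<epsilon> / 2" by (auto simp: \<phi>_def)
    then show ?thesis
      using \<open>dist c x < \<epsilon> / 2\<close> dist_triangle3[of x y c] by linarith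
  qed
  ultimately show ?thesis using that by blast
qed

section \<open>From single partitions to the metric entropy and small scales\<close>

locale compact_ergodic_system = ergodic_system M f
  for M :: "'a::metric_space measure" and f :: "'a \<Rightarrow> 'a" +
  assumes compact_UNIV: "compact (UNIV :: 'a set)" and sets_borel: "sets M = sets borel"
begin

lemma ergodic_borel_process:
  "finite_measurable_partition M P \<Longrightarrow> ergodic_borel_process M f P"
  by unfold_locales (simp_all add: sets_borel)

text \<open>The bound holds at every scale, not only in the limit: a partition into atoms of
  diameter at most \<open>\<epsilon>\<close> bounds the rate by its own entropy.\<close>

lemma limsup_sep_rate_le:
  assumes "\<epsilon> > 0" "\<gamma> > 0"
  shows "limsup (sep_rate M f \<gamma> g \<epsilon>) \<le> metric_entropy M f"
proof -
  obtain P where P: "finite_measurable_partition M P"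
    "\<And>B x y. B \<in> P \<Longrightarrow> x \<in> B \<Longrightarrow> y \<in> B \<Longrightarrow> dist x y \<le> \<epsilon>"
    using fine_partition_exists[OF compact_UNIV sets_borel assms(1)] by blast
  interpret ergodic_borel_process M f P by (rule ergodic_borel_process[OF P(1)])
  have "limsup (sep_rate M f \<gamma> g \<epsilon>) \<le> ereal entropy_rate"
  proof (rule ereal_le_epsilon2)
    fix \<delta> :: real assume "0 < \<delta>"
    have "limsup (sep_rate M f \<gamma> g \<epsilon>) \<le> ereal (entropy_rate + \<delta>)"
      by (rule Limsup_bounded[OF sep_rate_le[OF P(2) assms(2) \<open>0 < \<delta>\<close>]])
    then show "limsup (sep_rate M f \<gamma> g \<epsilon>) \<le> ereal entropy_rate + ereal \<delta>" by simp
  qed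
  also have "\<dots> \<le> metric_entropy M f"
    unfolding metric_entropy_def entropy_wrt_partition_eq[symmetric]
    using P(1) by (intro SUP_upper) auto
  finally show ?thesis .
qed

text \<open>One partition with entropy above \<open>c\<close> serves all mistake functions, so
  \<open>g\<close> is quantified inside the range of scales.\<close>

lemma liminf_span_rate_ge:
  assumes "\<gamma> < 1" "c < metric_entropy M f"
  shows "\<forall>\<^sub>F \<epsilon> in at_right 0. \<forall>\<epsilon>0 g. mistake_function \<epsilon>0 g \<longrightarrow> c < liminf (span_rate M f \<gamma> g \<epsilon>)"
proof -
  obtain P where P: "finite_measurable_partition M P" "c < ereal (entropy_wrt_partition M f P)"
    using assms(2) by (auto simp: metric_entropy_def less_SUP_iff)
  interpret ergodic_borel_process M f P by (rule ergodic_borel_process[OF P(1)])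
  obtain a where a: "c < ereal a" "a < entropy_rate"
    using ereal_dense2[OF P(2)] by (auto simp: entropy_wrt_partition_eq)
  obtain r where r: "r > 0"
    "\<And>\<epsilon> \<epsilon>0 g. 0 < \<epsilon> \<Longrightarrow> \<epsilon> < r \<Longrightarrow> mistake_function \<epsilon>0 g \<Longrightarrow>
       \<forall>\<^sub>F n in sequentially. ereal a \<le> span_rate M f \<gamma> g \<epsilon> n"
    using eventually_span_rate_ge[OF compact_UNIV assms(1) a(2)] by blast
  have "c < liminf (span_rate M f \<gamma> g \<epsilon>)" if "0 < \<epsilon>" "\<epsilon> < r" "mistake_function \<epsilon>0 g" for \<epsilon> \<epsilon>0 g
    by (rule less_le_trans[OF a(1) Liminf_bounded[OF r(2)[OF that]]])
  then show ?thesis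
    using r(1) by (auto simp: eventually_at_right_field)
qed

text \<open>The best lower bound independent of \<open>g\<close>, the witness for the last claim.
  Together with the metric entropy it encloses all four rates.\<close>

definition uniform_rate :: "real \<Rightarrow> real \<Rightarrow> ereal" where
  "uniform_rate \<gamma> \<epsilon> =
     (INF g\<in>{g. \<exists>\<epsilon>0. mistake_function \<epsilon>0 g}. liminf (span_rate M f \<gamma> g \<epsilon>))"

lemma uniform_rate_le:
  "mistake_function \<epsilon>0 g \<Longrightarrow> uniform_rate \<gamma> \<epsilon> \<le> liminf (span_rate M f \<gamma> g \<epsilon>)"
  unfolding uniform_rate_def by (intro INF_lower) auto

lemma rate_bounds:
  assumes "mistake_function \<epsilon>0 g" "\<epsilon> > 0" "\<gamma> > 0"
  shows "liminf (span_rate M f \<gamma> g \<epsilon>) \<le> limsup (span_rate M f \<gamma> g \<epsilon>)"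
    and "limsup (span_rate M f \<gamma> g \<epsilon>) \<le> metric_entropy M f"
    and "liminf (span_rate M f \<gamma> g \<epsilon>) \<le> liminf (sep_rate M f \<gamma> g \<epsilon>)"
    and "liminf (sep_rate M f \<gamma> g \<epsilon>) \<le> limsup (sep_rate M f \<gamma> g \<epsilon>)"
    and "limsup (sep_rate M f \<gamma> g \<epsilon>) \<le> metric_entropy M f"
proof -
  show *: "limsup (sep_rate M f \<gamma> g \<epsilon>) \<le> metric_entropy M f"
    by (rule limsup_sep_rate_le[OF assms(2,3)])
  show "limsup (span_rate M f \<gamma> g \<epsilon>) \<le> metric_entropy M f"
    by (rule order_trans[OF Limsup_mono[OF span_rate_le_sep_rate[OF assms(1,2)]] *])
  show "liminf (span_rate M f \<gamma> g \<epsilon>) \<le> liminf (sep_rate M f \<gamma> g \<epsilon>)"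
    by (rule Liminf_mono[OF span_rate_le_sep_rate[OF assms(1,2)]])
qed (simp_all add: Liminf_le_Limsup)

lemma uniform_rate_tendsto:
  assumes \<gamma>: "0 < \<gamma>" "\<gamma> < 1"
  shows "(uniform_rate \<gamma> \<longlongrightarrow> metric_entropy M f) (at_right 0)"
proof (rule order_tendstoI)
  fix c assume "c < metric_entropy M f"
  \<comment> \<open>An infimum of values above \<open>d\<close> is only known to be at least
    \<open>d\<close>, so room above \<open>c\<close> is kept.\<close>
  then obtain d where d: "c < d" "d < metric_entropy M f" using dense by blast
  show "\<forall>\<^sub>F \<epsilon> in at_right 0. c < uniform_rate \<gamma> \<epsilon>"
    using liminf_span_rate_ge[OF \<gamma>(2) d(2)]
  proof eventually_elim
    case (elim \<epsilon>)
    then have "d \<le> uniform_rate \<gamma> \<epsilon>"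
      unfolding uniform_rate_def by (intro INF_greatest) (auto intro: less_imp_le)
    then show ?case using d(1) by (rule less_le_trans[rotated])
  qed
next
  fix c assume c: "metric_entropy M f < c"
  \<comment> \<open>Any single mistake function bounds the infimum from above; the zero function is
    one.\<close>
  have "mistake_function 1 (\<lambda>_ _. 0)" by (simp add: mistake_function_def)
  then have "uniform_rate \<gamma> \<epsilon> \<le> metric_entropy M f" if "\<epsilon> > 0" for \<epsilon>
    using uniform_rate_le rate_bounds(1,2) that \<gamma>(1) by (meson order_trans)
  then show "\<forall>\<^sub>F \<epsilon> in at_right 0. uniform_rate \<gamma> \<epsilon> < c"
    using c by (auto intro!: eventually_mono[OF eventually_at_right_less] intro: order_le_less_trans)
qed

end

theorem theorem3p4:
  fixes f :: "'a::metric_space \<Rightarrow> 'a" and M :: "'a measure" and \<gamma> :: real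
  assumes "compact (UNIV :: 'a set)"
    and "continuous_on UNIV f"
    and "prob_space M" and "sets M = sets borel"
    and "ergodic_measure M f"
    and "0 < \<gamma>" and "\<gamma> < 1"
  shows "(\<forall>\<epsilon>0 g. mistake_function \<epsilon>0 g \<longrightarrow>
            ((\<lambda>\<epsilon>. liminf (span_rate M f \<gamma> g \<epsilon>)) \<longlongrightarrow> metric_entropy M f) (at_right 0) \<and>
            ((\<lambda>\<epsilon>. limsup (span_rate M f \<gamma> g \<epsilon>)) \<longlongrightarrow> metric_entropy M f) (at_right 0) \<and>
            ((\<lambda>\<epsilon>. liminf (sep_rate M f \<gamma> g \<epsilon>)) \<longlongrightarrow> metric_entropy M f) (at_right 0) \<and>
            ((\<lambda>\<epsilon>. limsup (sep_rate M f \<gamma> g \<epsilon>)) \<longlongrightarrow> metric_entropy M f) (at_right 0)) \<and>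
         (\<exists>L :: real \<Rightarrow> ereal. (L \<longlongrightarrow> metric_entropy M f) (at_right 0) \<and>
            (\<forall>\<epsilon>0 g. mistake_function \<epsilon>0 g \<longrightarrow>
               (\<forall>\<epsilon>>0. L \<epsilon> \<le> liminf (span_rate M f \<gamma> g \<epsilon>) \<and>
                       L \<epsilon> \<le> liminf (sep_rate M f \<gamma> g \<epsilon>))))"
proof -
  interpret prob_space M by fact
  interpret compact_ergodic_system M f
    using assms by unfold_locales (auto simp: ergodic_measure_def)
  have squeeze: "(R \<longlongrightarrow> metric_entropy M f) (at_right 0)"
    if "\<And>\<epsilon>. \<epsilon> > 0 \<Longrightarrow> uniform_rate \<gamma> \<epsilon> \<le> R \<epsilon> \<and> R \<epsilon> \<le> metric_entropy M f" for R
    by (rule tendsto_sandwich[OF _ _ uniform_rate_tendsto[OF assms(6,7)] tendsto_const])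
       (auto intro: eventually_mono[OF eventually_at_right_less] simp: that)
  have all: "((\<lambda>\<epsilon>. liminf (span_rate M f \<gamma> g \<epsilon>)) \<longlongrightarrow> metric_entropy M f) (at_right 0) \<and>
      ((\<lambda>\<epsilon>. limsup (span_rate M f \<gamma> g \<epsilon>)) \<longlongrightarrow> metric_entropy M f) (at_right 0) \<and>
      ((\<lambda>\<epsilon>. liminf (sep_rate M f \<gamma> g \<epsilon>)) \<longlongrightarrow> metric_entropy M f) (at_right 0) \<and>
      ((\<lambda>\<epsilon>. limsup (sep_rate M f \<gamma> g \<epsilon>)) \<longlongrightarrow> metric_entropy M f) (at_right 0)"
    if g: "mistake_function \<epsilon>0 g" for \<epsilon>0 g
    by (intro conjI squeeze; use uniform_rate_le[OF g, of \<gamma>] rate_bounds[OF g _ assms(6)] in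
        \<open>meson order_trans\<close>)
  have "uniform_rate \<gamma> \<epsilon> \<le> liminf (sep_rate M f \<gamma> g \<epsilon>)" if "mistake_function \<epsilon>0 g" "\<epsilon> > 0" for \<epsilon> \<epsilon>0 g
    by (rule order_trans[OF uniform_rate_le[OF that(1)] rate_bounds(3)[OF that assms(6)]])
  then show ?thesis
    using all uniform_rate_tendsto[OF assms(6,7)] uniform_rate_le by blast
qed

end
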